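(* (The local spectral mapping theorem) Let $T\in C^{\ast}_{\mathcal{E}}(\mathcal{D})$ be normal and $f\in C(\sigma_{loc}(T))$. Then $$\sigma_{loc}(f(T))=f(\sigma_{loc}(T))=\{f(\lambda):\lambda\in\sigma_{loc}(T)\}.$$
   Context: Let $(\Lambda,\le)$ be a directed partially ordered set and $\mathcal{E}=\{\mathcal{H}_\alpha\}_{\alpha\in\Lambda}$ a family of nonzero closed subspaces of a complex Hilbert space $\mathcal{H}$ with $\mathcal{H}_\alpha\subseteq\mathcal{H}_\beta$ for $\alpha\le\beta$, such that $\mathcal{D}=\bigcup_\alpha\mathcal{H}_\alpha$ is dense in $\mathcal{H}$. Let $P_\alpha$ be the orthogonal projection of $\mathcal{H}$ onto $\mathcal{H}_\alpha$. $C^{\ast}_{\mathcal{E}}(\mathcal{D})$ is the unital $\ast$-algebra of all linear $T:\mathcal{D}\to\mathcal{D}$ such that for every $\alpha$, $P_\alpha Tx=TP_\alpha x$ for all $x\in\mathcal{D}$ and $T_\alpha:=T|_{\mathcal{H}_\alpha}\in\mathcal{B}(\mathcal{H}_\alpha)$; the involution is determined by $T^{\ast}|_{\mathcal{H}_\alpha}=T_\alpha^{\ast}$, and $T$ is normal if $TT^{\ast}=T^{\ast}T$. The local spectrum $\sigma_{loc}(T)$ of any $T\in C^{\ast}_{\mathcal{E}}(\mathcal{D})$ is the set of $\lambda\in\mathbb{C}$ such that $\lambda I_{\mathcal{D}}-T$ is not invertible in $C^{\ast}_{\mathcal{E}}(\mathcal{D})$; it equals $\bigcup_\alpha\sigma(T_\alpha)$,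 with $\sigma(T_\alpha)\subseteq\sigma(T_\beta)$ for $\alpha\le\beta$. It is equipped with the inductive limit topology: $S\subseteq\sigma_{loc}(T)$ is open iff $S\cap\sigma(T_\alpha)$ is open in $\sigma(T_\alpha)$ for every $\alpha$. $C(\sigma_{loc}(T))$ is the algebra of continuous complex functions for this topology. For normal $T$ and $f\in C(\sigma_{loc}(T))$ put $f_\alpha=f|_{\sigma(T_\alpha)}$ and let $f_\alpha(T_\alpha)\in\mathcal{B}(\mathcal{H}_\alpha)$ be given by the usual continuous functional calculus of the bounded normal operator $T_\alpha$. For $\alpha\le\beta$, $\mathcal{H}_\alpha$ reduces $f_\beta(T_\beta)$ and $f_\beta(T_\beta)|_{\mathcal{H}_\alpha}=f_\alpha(T_\alpha)$; $f(T)$ is the unique element of $C^{\ast}_{\mathcal{E}}(\mathcal{D})$ with $f(T)|_{\mathcal{H}_\alpha}=f_\alpha(T_\alpha)$ for all $\alpha$. *)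

theory Defs
  imports "HOL-Analysis.Analysis"
begin

section \<open>Complex Hilbert spaces\<close>

text \<open>The norm and the topology are those of the underlying real inner product space: by
  \<open>inner_eq_Re_cinner\<close> the norm of \<open>x\<close> is the square root of \<open>Re (cinner x x)\<close>, and
  \<open>cinner x x\<close> is real by \<open>cinner_commute\<close>.  The inner product is linear in the first argument.\<close>

class complex_inner = real_inner +
  fixes scaleC :: "complex \<Rightarrow> 'a \<Rightarrow> 'a" (infixr "*\<^sub>C" 75)
    and cinner :: "'a \<Rightarrow> 'a \<Rightarrow> complex"
  assumes scaleC_add_right: "c *\<^sub>C (x + y) = c *\<^sub>C x + c *\<^sub>C y"
    and scaleC_add_left: "(c + d) *\<^sub>C x = c *\<^sub>C x + d *\<^sub>C x"
    and scaleC_scaleC: "c *\<^sub>C d *\<^sub>C x = (c * d) *\<^sub>C x"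
    and scaleC_one: "1 *\<^sub>C x = x"
    and scaleR_scaleC: "r *\<^sub>R x = complex_of_real r *\<^sub>C x"
    and cinner_commute: "cinner x y = cnj (cinner y x)"
    and cinner_add_left: "cinner (x + y) z = cinner x z + cinner y z"
    and cinner_scaleC_left: "cinner (c *\<^sub>C x) y = c * cinner x y"
    and inner_eq_Re_cinner: "inner x y = Re (cinner x y)"

class complex_hilbert = complex_inner + complete_space

global_interpretation complex_vector: vector_space "scaleC :: complex \<Rightarrow> 'a \<Rightarrow> 'a::complex_inner"
  by standard (simp_all add: scaleC_add_right scaleC_add_left scaleC_scaleC scaleC_one)

definition orth_proj :: "'a::complex_inner set \<Rightarrow> 'a \<Rightarrow> 'a" where
  "orth_proj M x = (THE y. y \<in> M \<and> (\<forall>z\<in>M. cinner (x - y) z = 0))"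


section \<open>Bounded operators on a subspace\<close>

text \<open>An operator on a subspace \<open>M\<close> is represented by a function that is \<open>extensional\<close> on \<open>M\<close>,
  so that two operators are equal iff they agree on \<open>M\<close>.\<close>

definition clinear_on :: "'a::complex_inner set \<Rightarrow> ('a \<Rightarrow> 'a) \<Rightarrow> bool" where
  "clinear_on M A \<longleftrightarrow>
     (\<forall>x\<in>M. \<forall>y\<in>M. A (x + y) = A x + A y) \<and> (\<forall>c. \<forall>x\<in>M. A (c *\<^sub>C x) = c *\<^sub>C A x)"

definition bounded_ops :: "'a::complex_inner set \<Rightarrow> ('a \<Rightarrow> 'a) set" where
  "bounded_ops M = {A \<in> M \<rightarrow>\<^sub>E M. clinear_on M A \<and> (\<exists>K. \<forall>x\<in>M. norm (A x) \<le> K * norm x)}"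

definition op_norm :: "'a::complex_inner set \<Rightarrow> ('a \<Rightarrow> 'a) \<Rightarrow> real" where
  "op_norm M A = (SUP x\<in>M. norm (A x) / norm x)"

definition op_adjoint :: "'a::complex_inner set \<Rightarrow> ('a \<Rightarrow> 'a) \<Rightarrow> ('a \<Rightarrow> 'a)" where
  "op_adjoint M A =
     (THE B. B \<in> bounded_ops M \<and> (\<forall>x\<in>M. \<forall>y\<in>M. cinner (A x) y = cinner x (B y)))"

text \<open>Invertibility of \<open>A\<close> in an algebra \<open>\<A>\<close> of operators on \<open>M\<close>, and the spectrum relative to \<open>\<A>\<close>.\<close>

definition invertible_in :: "('a \<Rightarrow> 'a) set \<Rightarrow> 'a set \<Rightarrow> ('a \<Rightarrow> 'a) \<Rightarrow> bool" where
  "invertible_in \<A> M A \<longleftrightarrow>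
     A \<in> \<A> \<and> (\<exists>B\<in>\<A>. compose M A B = (\<lambda>x\<in>M. x) \<and> compose M B A = (\<lambda>x\<in>M. x))"

definition spectrum_in ::
    "('a::complex_inner \<Rightarrow> 'a) set \<Rightarrow> 'a set \<Rightarrow> ('a \<Rightarrow> 'a) \<Rightarrow> complex set" where
  "spectrum_in \<A> M A = {l. \<not> invertible_in \<A> M (\<lambda>x\<in>M. l *\<^sub>C x - A x)}"

definition op_spectrum :: "'a::complex_inner set \<Rightarrow> ('a \<Rightarrow> 'a) \<Rightarrow> complex set" where
  "op_spectrum M A = spectrum_in (bounded_ops M) M A"


section \<open>Continuous functional calculus of a bounded normal operator\<close>

text \<open>\<open>\<Phi>\<close> is an isometric unital \<open>*\<close>-homomorphism from the continuous functions on the spectrum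
  of \<open>A\<close> (with the supremum norm) to the bounded operators on \<open>M\<close>, sending the identity function
  to \<open>A\<close>.  Functions on the spectrum are represented by total functions; the isometry condition
  makes \<open>\<Phi> f\<close> depend only on the values of \<open>f\<close> on the spectrum.\<close>

definition functional_calculus ::
    "'a::complex_inner set \<Rightarrow> ('a \<Rightarrow> 'a) \<Rightarrow> ((complex \<Rightarrow> complex) \<Rightarrow> ('a \<Rightarrow> 'a)) \<Rightarrow> bool" where
  "functional_calculus M A \<Phi> \<longleftrightarrow>
     (let C = {f. continuous_on (op_spectrum M A) f} in
       (\<forall>f\<in>C. \<Phi> f \<in> bounded_ops M) \<and>
       (\<forall>f\<in>C. \<forall>g\<in>C. \<Phi> (\<lambda>z. f z + g z) = (\<lambda>x\<in>M. \<Phi> f x + \<Phi> g x)) \<and>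
       (\<forall>c. \<forall>f\<in>C. \<Phi> (\<lambda>z. c * f z) = (\<lambda>x\<in>M. c *\<^sub>C \<Phi> f x)) \<and>
       (\<forall>f\<in>C. \<forall>g\<in>C. \<Phi> (\<lambda>z. f z * g z) = compose M (\<Phi> f) (\<Phi> g)) \<and>
       (\<forall>f\<in>C. \<Phi> (\<lambda>z. cnj (f z)) = op_adjoint M (\<Phi> f)) \<and>
       (\<forall>f\<in>C. op_norm M (\<Phi> f) = (SUP z\<in>op_spectrum M A. norm (f z))) \<and>
       \<Phi> (\<lambda>z. 1) = (\<lambda>x\<in>M. x) \<and>
       \<Phi> (\<lambda>z. z) = A)"

definition apply_fun :: "'a::complex_inner set \<Rightarrow> (complex \<Rightarrow> complex) \<Rightarrow> ('a \<Rightarrow> 'a) \<Rightarrow> ('a \<Rightarrow> 'a)"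
  where "apply_fun M f A = (THE B. \<exists>\<Phi>. functional_calculus M A \<Phi> \<and> B = \<Phi> f)"


section \<open>The local algebra of a directed family of closed subspaces\<close>

locale subspace_family =
  fixes H :: "'i::order \<Rightarrow> 'a::complex_hilbert set"
  assumes directed: "\<And>\<alpha> \<beta> :: 'i. \<exists>\<gamma>. \<alpha> \<le> \<gamma> \<and> \<beta> \<le> \<gamma>"
    and subspace_H: "\<And>\<alpha>. complex_vector.subspace (H \<alpha>)"
    and closed_H: "\<And>\<alpha>. closed (H \<alpha>)"
    and nonzero_H: "\<And>\<alpha>. H \<alpha> \<noteq> {0}"
    and increasing_H: "\<And>\<alpha> \<beta>. \<alpha> \<le> \<beta> \<Longrightarrow> H \<alpha> \<subseteq> H \<beta>"
    and dense_H: "closure (\<Union>\<alpha>. H \<alpha>) = UNIV"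

definition local_domain :: "('i \<Rightarrow> 'a::complex_inner set) \<Rightarrow> 'a set" where
  "local_domain H = (\<Union>\<alpha>. H \<alpha>)"

definition local_algebra :: "('i \<Rightarrow> 'a::complex_inner set) \<Rightarrow> ('a \<Rightarrow> 'a) set" where
  "local_algebra H =
     {T \<in> local_domain H \<rightarrow>\<^sub>E local_domain H. clinear_on (local_domain H) T \<and>
        (\<forall>\<alpha>. (\<forall>x\<in>local_domain H. orth_proj (H \<alpha>) (T x) = T (orth_proj (H \<alpha>) x)) \<and>
              restrict T (H \<alpha>) \<in> bounded_ops (H \<alpha>))}"

definition local_adjoint :: "('i \<Rightarrow> 'a::complex_inner set) \<Rightarrow> ('a \<Rightarrow> 'a) \<Rightarrow> ('a \<Rightarrow> 'a)" where
  "local_adjoint H T =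
     (THE S. S \<in> local_algebra H \<and>
        (\<forall>\<alpha>. restrict S (H \<alpha>) = op_adjoint (H \<alpha>) (restrict T (H \<alpha>))))"

definition local_normal :: "('i \<Rightarrow> 'a::complex_inner set) \<Rightarrow> ('a \<Rightarrow> 'a) \<Rightarrow> bool" where
  "local_normal H T \<longleftrightarrow>
     compose (local_domain H) T (local_adjoint H T) = compose (local_domain H) (local_adjoint H T) T"

definition local_spectrum :: "('i \<Rightarrow> 'a::complex_inner set) \<Rightarrow> ('a \<Rightarrow> 'a) \<Rightarrow> complex set" where
  "local_spectrum H T = spectrum_in (local_algebra H) (local_domain H) T"

text \<open>The inductive limit topology, which may be finer than the topology inherited from the
  complex plane.\<close>

definition local_spectrum_topology ::
    "('i \<Rightarrow> 'a::complex_inner set) \<Rightarrow> ('a \<Rightarrow> 'a) \<Rightarrow> complex topology" where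
  "local_spectrum_topology H T =
     topology (\<lambda>S. S \<subseteq> local_spectrum H T \<and>
       (\<forall>\<alpha>. openin (top_of_set (op_spectrum (H \<alpha>) (restrict T (H \<alpha>))))
               (S \<inter> op_spectrum (H \<alpha>) (restrict T (H \<alpha>)))))"

lemma openin_local_spectrum_topology:
  "openin (local_spectrum_topology H T) S \<longleftrightarrow>
     S \<subseteq> local_spectrum H T \<and>
     (\<forall>\<alpha>. openin (top_of_set (op_spectrum (H \<alpha>) (restrict T (H \<alpha>))))
             (S \<inter> op_spectrum (H \<alpha>) (restrict T (H \<alpha>))))"
proof -
  have "istopology (\<lambda>S. S \<subseteq> local_spectrum H T \<and>
       (\<forall>\<alpha>. openin (top_of_set (op_spectrum (H \<alpha>) (restrict T (H \<alpha>))))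
               (S \<inter> op_spectrum (H \<alpha>) (restrict T (H \<alpha>)))))" (is "istopology ?P")
    unfolding istopology_def
  proof (intro conjI allI impI)
    fix S S' assume "?P S" "?P S'"
    then show "S \<inter> S' \<subseteq> local_spectrum H T" by blast
    fix \<alpha>
    let ?s = "op_spectrum (H \<alpha>) (restrict T (H \<alpha>))"
    have "S \<inter> S' \<inter> ?s = (S \<inter> ?s) \<inter> (S' \<inter> ?s)" by blast
    with \<open>?P S\<close> \<open>?P S'\<close> show "openin (top_of_set ?s) (S \<inter> S' \<inter> ?s)"
      by (metis (no_types, lifting) openin_Int)
  next
    fix K assume K: "\<forall>S\<in>K. ?P S"
    then show "\<Union>K \<subseteq> local_spectrum H T" by blast
    fix \<alpha>
    let ?s = "op_spectrum (H \<alpha>) (restrict T (H \<alpha>))"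
    have "\<Union>K \<inter> ?s = (\<Union>S\<in>K. S \<inter> ?s)" by blast
    moreover have "openin (top_of_set ?s) (\<Union>S\<in>K. S \<inter> ?s)"
      using K by (intro openin_Union) auto
    ultimately show "openin (top_of_set ?s) (\<Union>K \<inter> ?s)" by simp
  qed
  then show ?thesis
    unfolding local_spectrum_topology_def by (simp add: topology_inverse')
qed

lemma topspace_local_spectrum_topology:
  assumes "\<And>\<alpha>. op_spectrum (H \<alpha>) (restrict T (H \<alpha>)) \<subseteq> local_spectrum H T"
  shows "topspace (local_spectrum_topology H T) = local_spectrum H T"
proof -
  have "openin (local_spectrum_topology H T) (local_spectrum H T)"
    unfolding openin_local_spectrum_topology
    using assms by (simp add: Int_absorb1)
  then show ?thesis
    by (metis openin_local_spectrum_topology openin_subset openin_topspace subset_antisym)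
qed

definition local_apply_fun ::
    "('i \<Rightarrow> 'a::complex_inner set) \<Rightarrow> (complex \<Rightarrow> complex) \<Rightarrow> ('a \<Rightarrow> 'a) \<Rightarrow> ('a \<Rightarrow> 'a)" where
  "local_apply_fun H f T =
     (THE S. S \<in> local_algebra H \<and>
        (\<forall>\<alpha>. restrict S (H \<alpha>) = apply_fun (H \<alpha>) f (restrict T (H \<alpha>))))"

end

theory Submission imports Defs begin

text \<open>Since \<open>local_spectrum H T\<close> is the union of the spectra of the restrictions of \<open>T\<close>, and
  \<open>local_apply_fun H f T\<close> restricts to the continuous functional calculus on each \<open>H \<alpha>\<close>, the theorem
  reduces to the spectral mapping theorem for a bounded normal operator \<open>A\<close>.

  For such an \<open>A\<close>, every operator \<open>F = p(A, A\<^sup>*)\<close> satisfies \<open>norm F = \<bar>p l\<bar>\<close> for some spectral value \<open>l\<close>: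
  the operators \<open>\<parallel>F\<parallel>\<^sup>2 - F\<^sup>* F\<close>, \<open>(A + A\<^sup>*)/2\<close> and \<open>(A - A\<^sup>*)/(2 i)\<close> commute and are self-adjoint, and the first has
  approximate null vectors, so all three have common approximate eigenvectors.  This replaces the
  spectral radius formula and Gelfand theory.  By Stone--Weierstrass the
  calculus extends isometrically to all continuous functions.  Spectra of normal operators consist of
  approximate eigenvalues, which gives one inclusion of the spectral mapping theorem; applying the
  calculus to \<open>1/(m - f)\<close> gives the other.\<close>

section \<open>Closed subspaces and bounded operators on them\<close>

text \<open>Both \<open>apply_fun\<close> and \<open>local_apply_fun\<close> are definite
  descriptions, so nothing is known about them before unique existence is proved, and this includes
  the compatibility of the calculus on \<open>H \<beta>\<close> with that on a smaller
  \<open>H \<alpha>\<close>. An inductive relation between functions and operators serves these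
  needs: everything is built from the operator and its adjoint, both of which pass to reducing
  subspaces, so one rule induction gives compatibility and another shows that every functional
  calculus agrees with the relation. The obstacle is that the relation is not visibly single-valued:
  expressions that agree on the spectrum might define different operators. The norm identity
  excludes this, so it has to be proved for the relation itself, before operators can be assigned to
  functions. A spectral value need not have an eigenvector, hence the approximate ones; common ones
  come from maximising a quadratic form under a growing penalty. On the local side an element is
  bounded on each \<open>H \<alpha>\<close> separately. Inverses found level by level therefore glue
  without a uniform bound, and the union of the spectra is taken without closure.\<close>

lemma cinner_add_right: "cinner x (y + z) = cinner x y + cinner x (z::'a::complex_inner)"
  by (metis cinner_add_left cinner_commute complex_cnj_add)

lemma cinner_scaleC_right: "cinner x (c *\<^sub>C y) = cnj c * cinner x (y::'a::complex_inner)"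
  by (metis cinner_commute cinner_scaleC_left complex_cnj_mult)

lemma minus_eq_scaleC: "- x = (-1) *\<^sub>C (x::'a::complex_inner)"
  using complex_vector.scale_minus_left[of 1 x] by simp

lemma cinner_diff_left: "cinner (x - y) z = cinner x z - cinner y (z::'a::complex_inner)"
  using cinner_add_left[of "x - y" y z] by simp

lemma cinner_diff_right: "cinner z (x - y) = cinner z x - cinner z (y::'a::complex_inner)"
  using cinner_add_right[of z "x - y" y] by simp

lemma Im_cinner: "Im (cinner x y) = - inner (\<i> *\<^sub>C x) (y::'a::complex_inner)"
  by (simp add: inner_eq_Re_cinner cinner_scaleC_left)

lemma cinner_self: "cinner x x = complex_of_real ((norm (x::'a::complex_inner))\<^sup>2)"
proof -
  have "Im (cinner x x) = 0"
    using arg_cong[OF cinner_commute[of x x], of Im] by simp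
  moreover have "Re (cinner x x) = (norm x)\<^sup>2"
    by (metis inner_eq_Re_cinner power2_norm_eq_inner)
  ultimately show ?thesis by (simp add: complex_eq_iff)
qed

lemma norm_scaleC: "norm (c *\<^sub>C x) = cmod c * norm (x::'a::complex_inner)"
proof -
  have "complex_of_real ((norm (c *\<^sub>C x))\<^sup>2) = c * cnj c * complex_of_real ((norm x)\<^sup>2)"
    by (simp only: cinner_self [symmetric] cinner_scaleC_left cinner_scaleC_right) simp
  also have "\<dots> = complex_of_real ((cmod c * norm x)\<^sup>2)"
    by (simp only: power_mult_distrib of_real_mult complex_norm_square)
  finally have "(norm (c *\<^sub>C x))\<^sup>2 = (cmod c * norm x)\<^sup>2"
    using of_real_eq_iff by blast
  then show ?thesis by (simp add: power2_eq_iff_nonneg)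
qed

lemma bounded_linear_scaleC: "bounded_linear (\<lambda>x::'a::complex_inner. c *\<^sub>C x)"
proof (rule bounded_linear_intro)
  show "c *\<^sub>C (r *\<^sub>R x) = r *\<^sub>R c *\<^sub>C x" for r and x :: 'a
    by (simp add: scaleR_scaleC scaleC_scaleC mult.commute)
  show "norm (c *\<^sub>C x) \<le> norm x * cmod c" for x :: 'a
    by (simp add: norm_scaleC)
qed (simp add: scaleC_add_right)

lemma norm_add_diff_le: "norm (a + b - c) \<le> norm a + norm b + norm (c::'a::real_normed_vector)"
  by (rule order_trans[OF norm_triangle_ineq4 add_right_mono[OF norm_triangle_ineq]])

text \<open>Turns the estimates "within e on every vector" that the uniform limits of the calculus
  provide into exact identities.\<close>

lemma small_imp_zero:
  fixes x :: "'b::real_normed_vector"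
  assumes "\<And>e. e > 0 \<Longrightarrow> norm x \<le> e * K"
  shows "x = 0"
proof -
  have "norm x \<le> e" if "e > 0" for e
  proof -
    \<comment> \<open>Dividing by |K| + 1 instead of K covers zero and negative K as well.\<close>
    have "norm x \<le> e / (\<bar>K\<bar> + 1) * K" using that by (intro assms) simp
    also have "\<dots> \<le> e"
      using that mult_left_mono[of K "\<bar>K\<bar> + 1" e] by (simp add: pos_divide_le_eq)
    finally show ?thesis .
  qed
  then show ?thesis by (metis dense_ge norm_le_zero_iff)
qed

section \<open>Real orthogonality and Riesz representation on a closed complex subspace\<close>

lemma csubspace_imp_subspace:
  "complex_vector.subspace M \<Longrightarrow> subspace (M::'a::complex_inner set)"
  by (simp add: complex_vector.subspace_def subspace_def scaleR_scaleC)

text \<open>Replacing z by i z exchanges real and imaginary parts up to sign, and a complex subspace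
  contains i z. So results on real inner products carry over to \<open>cinner\<close>.\<close>

lemma cinner_eq_zero_iff_inner:
  fixes M :: "'a::complex_inner set"
  assumes M: "complex_vector.subspace M"
  shows "(\<forall>z\<in>M. cinner x z = 0) \<longleftrightarrow> (\<forall>z\<in>M. inner x z = 0)"
proof safe
  fix z assume *: "\<forall>z\<in>M. inner x z = 0" and z: "z \<in> M"
  have "\<i> *\<^sub>C z \<in> M"
    using z M by (simp add: complex_vector.subspace_def)
  then have "inner x z = 0" "inner x (\<i> *\<^sub>C z) = 0"
    using * z by auto
  then show "cinner x z = 0"
    by (simp add: inner_eq_Re_cinner cinner_scaleC_right complex_eq_iff)
qed (simp add: inner_eq_Re_cinner)

text \<open>The representing vector minimises \<open>(norm x)\<^sup>2 - 2 * \<phi> x\<close> over \<open>M\<close>; taking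
  \<open>\<phi> x = inner x a\<close> yields the orthogonal projection of \<open>a\<close>.\<close>

lemma Riesz_on_closed_subspace:
  fixes \<phi> :: "'a::{real_inner, complete_space} \<Rightarrow> real"
  assumes M: "subspace M" "closed M"
    and add: "\<And>x y. x \<in> M \<Longrightarrow> y \<in> M \<Longrightarrow> \<phi> (x + y) = \<phi> x + \<phi> y"
    and scale: "\<And>r x. x \<in> M \<Longrightarrow> \<phi> (r *\<^sub>R x) = r * \<phi> x"
    and bound: "\<And>x. x \<in> M \<Longrightarrow> \<bar>\<phi> x\<bar> \<le> K * norm x"
  shows "\<exists>y\<in>M. \<forall>x\<in>M. \<phi> x = inner x y"
proof -
  define J where "J x = (norm x)\<^sup>2 - 2 * \<phi> x" for x
  define d where "d = (INF x\<in>M. J x)"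
  have M0: "0 \<in> M" and Madd: "\<And>x y. x \<in> M \<Longrightarrow> y \<in> M \<Longrightarrow> x + y \<in> M"
    and Msc: "\<And>r x. x \<in> M \<Longrightarrow> r *\<^sub>R x \<in> M"
    using M by (auto simp: subspace_def)
  have Jge: "J x \<ge> - K\<^sup>2" if "x \<in> M" for x
  proof -
    have "0 \<le> (norm x - K)\<^sup>2" by simp
    then show ?thesis
      using bound[OF that] by (simp add: J_def power2_eq_square algebra_simps abs_le_iff)
  qed
  then have bdd: "bdd_below (J ` M)" by (intro bdd_belowI2)
  have d_le: "d \<le> J x" if "x \<in> M" for x
    unfolding d_def using bdd that by (rule cINF_lower)
  have "\<exists>x\<in>M. J x < d + 1 / Suc n" for n
    using cINF_less_iff[of M J "d + 1 / Suc n"] bdd M0 unfolding d_def by auto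
  then obtain u where u: "\<And>n. u n \<in> M" "\<And>n. J (u n) < d + 1 / Suc n"
    by metis
  \<comment> \<open>Parallelogram law; additivity of \<open>\<phi>\<close> makes the linear terms
    cancel. As J is at least d at the midpoint, two near-minimisers are close together.\<close>
  have par: "(norm (x - y))\<^sup>2 = 2 * J x + 2 * J y - 4 * J ((1/2) *\<^sub>R (x + y))"
    if "x \<in> M" "y \<in> M" for x y
    using that scale[of "x + y" "1/2"] Madd[of x y] add[of x y]
    by (simp add: J_def power2_norm_eq_inner algebra_simps inner_commute power_divide)
  have dist: "(norm (u m - u n))\<^sup>2 \<le> 2 / Suc m + 2 / Suc n" for m n
    using par[OF u(1) u(1), of m n] d_le[OF Msc[OF Madd[OF u(1) u(1)]], of "1/2" m n] u(2)[of m] u(2)[of n]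
    by auto
  have "Cauchy u"
    unfolding Cauchy_iff
  proof (intro allI impI)
    fix e :: real assume "e > 0"
    then obtain N where N: "1 / Suc N < e\<^sup>2 / 4"
      by (metis nat_approx_posE divide_pos_pos zero_less_numeral zero_less_power)
    have "norm (u m - u n) < e" if "m \<ge> N" "n \<ge> N" for m n
    proof -
      have *: "2 / real (Suc k) \<le> 2 * (1 / Suc N)" if "k \<ge> N" for k
        using that by (simp add: frac_le)
      have "(norm (u m - u n))\<^sup>2 < e\<^sup>2"
        using dist[of m n] *[OF that(1)] *[OF that(2)] N by linarith
      then show ?thesis
        using \<open>e > 0\<close> power_less_imp_less_base by (metis less_eq_real_def)
    qed
    then show "\<exists>N. \<forall>m\<ge>N. \<forall>n\<ge>N. norm (u m - u n) < e" by blast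
  qed
  then obtain y where y: "u \<longlonglongrightarrow> y"
    using Cauchy_convergent convergent_def by blast
  have yM: "y \<in> M"
    using closed_sequentially[OF M(2)] u(1) y by blast
  have diff: "\<phi> (a - b) = \<phi> a - \<phi> b" if "a \<in> M" "b \<in> M" for a b
    using add[of a "(-1) *\<^sub>R b"] scale[of b "-1"] Msc[of b "-1"] that by simp
  have "(\<lambda>n. \<phi> (u n)) \<longlonglongrightarrow> \<phi> y"
  proof (rule LIM_zero_cancel, rule Lim_null_comparison)
    show "\<forall>\<^sub>F n in sequentially. norm (\<phi> (u n) - \<phi> y) \<le> K * norm (u n - y)"
      using bound[OF subspace_diff[OF M(1) u(1) yM]] diff[OF u(1) yM] by auto
    show "(\<lambda>n. K * norm (u n - y)) \<longlonglongrightarrow> 0"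
      using tendsto_mult_right_zero[OF tendsto_norm_zero[OF LIM_zero[OF y]]] .
  qed
  then have "(\<lambda>n. J (u n)) \<longlonglongrightarrow> J y"
    unfolding J_def by (intro tendsto_intros y)
  moreover have "(\<lambda>n. d + 1 / Suc n) \<longlonglongrightarrow> d"
    using tendsto_add[OF tendsto_const lim_inverse_n'[THEN LIMSEQ_Suc]] by simp
  ultimately have "J y \<le> d"
    using u(2) by (intro LIMSEQ_le) (auto intro: less_imp_le)
  have "\<phi> h = inner h y" if h: "h \<in> M" for h
  proof (rule ccontr)
    assume ne: "\<phi> h \<noteq> inner h y"
    define k where "k = inner h y - \<phi> h"
    have ineq: "0 \<le> s\<^sup>2 * (norm h)\<^sup>2 + 2 * s * k" for s
    proof -
      have "J y \<le> J (y + s *\<^sub>R h)"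
        using \<open>J y \<le> d\<close> d_le[OF Madd[OF yM Msc[OF h]]] by (rule order_trans)
      then show ?thesis
        using add[OF yM Msc[OF h]] scale[OF h]
        by (simp only: J_def k_def power2_norm_eq_inner) (simp add: algebra_simps inner_commute power2_eq_square)
    qed
    \<comment> \<open>The variation of J along h is s^2 (norm h)^2 + 2 s k, and s = -k/q makes it
      negative unless k = 0. The added 1 keeps q positive when h = 0.\<close>
    define q where "q = (norm h)\<^sup>2 + 1"
    have q: "q > 0" unfolding q_def by (metis add_nonneg_pos zero_le_power2 zero_less_one)
    have "0 \<le> (k/q)\<^sup>2 * (norm h)\<^sup>2 - 2 * (k/q) * k"
      using ineq[of "- k/q"] by simp
    also have "\<dots> = k\<^sup>2 / q\<^sup>2 * (q - 1 - 2 * q)"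
      using q by (simp add: q_def[symmetric] power2_eq_square field_simps) (simp add: q_def power2_eq_square algebra_simps)
    also have "\<dots> < 0"
      using ne q by (intro mult_pos_neg) (auto simp: k_def)
    finally show False by simp
  qed
  with yM show ?thesis by blast
qed

text \<open>Instantiated with every \<open>H \<alpha>\<close>, and also with the range of l - F
  inside \<open>approx_eigenvector_of_spectrum\<close>, where the projection onto that range is
  needed.\<close>

locale closed_csubspace =
  fixes M :: "'a::complex_hilbert set"
  assumes csub: "complex_vector.subspace M" and closedM: "closed M"
begin

lemma zero_mem [simp]: "0 \<in> M"
  and add_mem [simp]: "x \<in> M \<Longrightarrow> y \<in> M \<Longrightarrow> x + y \<in> M"
  and scaleC_mem [simp]: "x \<in> M \<Longrightarrow> c *\<^sub>C x \<in> M"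
  using csub by (auto simp: complex_vector.subspace_def)

lemma diff_mem [simp]: "x \<in> M \<Longrightarrow> y \<in> M \<Longrightarrow> x - y \<in> M"
  using csub by (rule complex_vector.subspace_diff)

lemma scaleR_mem [simp]: "x \<in> M \<Longrightarrow> r *\<^sub>R x \<in> M"
  by (simp add: scaleR_scaleC)

lemma eq_if_cinner_eq:
  assumes "x \<in> M" "y \<in> M" "\<And>z. z \<in> M \<Longrightarrow> cinner z x = cinner z y"
  shows "x = y"
  using assms(3)[of "x - y"] assms(1,2) cinner_self[of "x - y"] by (simp add: cinner_diff_right)

section \<open>Orthogonal projection onto a closed subspace\<close>

lemma orth_proj_exists: "\<exists>!y. y \<in> M \<and> (\<forall>z\<in>M. cinner (x - y) z = 0)"
proof -
  have "\<exists>y\<in>M. \<forall>z\<in>M. inner z x = inner z y"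
    using csubspace_imp_subspace[OF csub] closedM
    by (rule Riesz_on_closed_subspace[where K = "norm x"])
      (auto simp: algebra_simps Cauchy_Schwarz_ineq2 mult.commute)
  then obtain y where y: "y \<in> M" "\<And>z. z \<in> M \<Longrightarrow> inner z x = inner z y" by blast
  then have "\<forall>z\<in>M. inner (x - y) z = 0"
    by (metis inner_commute inner_diff_right right_minus_eq)
  then have "\<forall>z\<in>M. cinner (x - y) z = 0"
    using cinner_eq_zero_iff_inner[OF csub] by blast
  moreover have "y' = y" if "y' \<in> M" "\<forall>z\<in>M. cinner (x - y') z = 0" for y'
  proof (rule eq_if_cinner_eq[OF that(1) y(1)])
    fix z assume "z \<in> M"
    then have "cinner y' z = cinner y z"
      using that(2) calculation by (simp add: cinner_diff_left)
    then show "cinner z y' = cinner z y" by (metis cinner_commute)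
  qed
  ultimately show ?thesis using y(1) by blast
qed

lemma orth_proj_mem [simp]: "orth_proj M x \<in> M"
  and orth_proj_orth: "z \<in> M \<Longrightarrow> cinner (x - orth_proj M x) z = 0"
  using theI'[OF orth_proj_exists[of x]] unfolding orth_proj_def by auto

lemma orth_projI: "y \<in> M \<Longrightarrow> (\<And>z. z \<in> M \<Longrightarrow> cinner (x - y) z = 0) \<Longrightarrow> orth_proj M x = y"
  unfolding orth_proj_def by (rule the1_equality[OF orth_proj_exists]) auto

lemma orth_proj_self [simp]: "x \<in> M \<Longrightarrow> orth_proj M x = x"
  using cinner_diff_left[of x x] by (intro orth_projI) simp_all

lemma cinner_orth_proj: "cinner (orth_proj M x) y = cinner x (orth_proj M y)"
proof -
  have "cinner (orth_proj M x) y = cinner (orth_proj M x) (orth_proj M y)"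
    using orth_proj_orth[of "orth_proj M x" y] cinner_commute[of "orth_proj M x"]
    by (metis cinner_diff_left eq_iff_diff_eq_0 orth_proj_mem)
  also have "\<dots> = cinner x (orth_proj M y)"
    using orth_proj_orth[of "orth_proj M y" x] by (simp add: cinner_diff_left)
  finally show ?thesis .
qed

lemma orth_proj_add: "orth_proj M (x + y) = orth_proj M x + orth_proj M y"
proof (rule orth_projI)
  fix z assume "z \<in> M"
  then show "cinner (x + y - (orth_proj M x + orth_proj M y)) z = 0"
    using orth_proj_orth[of z x] orth_proj_orth[of z y]
    by (simp add: cinner_diff_left cinner_add_left algebra_simps)
qed simp

lemma orth_proj_diff: "orth_proj M (x - y) = orth_proj M x - orth_proj M y"
  using orth_proj_add[of "x - y" y] by simp

lemma orth_proj_scaleC: "orth_proj M (c *\<^sub>C x) = c *\<^sub>C orth_proj M x"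
proof (rule orth_projI)
  fix z assume "z \<in> M"
  then show "cinner (c *\<^sub>C x - c *\<^sub>C orth_proj M x) z = 0"
    using orth_proj_orth[of z x]
    by (simp add: cinner_diff_left cinner_scaleC_left algebra_simps)
qed simp

lemma norm_orth_proj_le: "norm (orth_proj M x) \<le> norm x"
proof -
  have "(norm (orth_proj M x))\<^sup>2 = inner x (orth_proj M x)"
    using cinner_orth_proj[of x "orth_proj M x"] by (simp add: power2_norm_eq_inner inner_eq_Re_cinner)
  also have "\<dots> \<le> norm x * norm (orth_proj M x)" by (rule norm_cauchy_schwarz)
  finally show ?thesis
    by (cases "norm (orth_proj M x) = 0") (simp_all add: power2_eq_square)
qed

section \<open>The algebra of bounded operators on a closed subspace\<close>

lemma op_mem [simp]: "F \<in> bounded_ops M \<Longrightarrow> x \<in> M \<Longrightarrow> F x \<in> M"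
  and op_add: "F \<in> bounded_ops M \<Longrightarrow> x \<in> M \<Longrightarrow> y \<in> M \<Longrightarrow> F (x + y) = F x + F y"
  and op_scaleC: "F \<in> bounded_ops M \<Longrightarrow> x \<in> M \<Longrightarrow> F (c *\<^sub>C x) = c *\<^sub>C F x"
  by (auto simp: bounded_ops_def clinear_on_def)

lemma op_scaleR: "F \<in> bounded_ops M \<Longrightarrow> x \<in> M \<Longrightarrow> F (r *\<^sub>R x) = r *\<^sub>R F x"
  by (simp add: scaleR_scaleC op_scaleC)

lemma op_diff: "F \<in> bounded_ops M \<Longrightarrow> x \<in> M \<Longrightarrow> y \<in> M \<Longrightarrow> F (x - y) = F x - F y"
  using op_add[of F "x - y" y] by simp

lemma op_minus: "F \<in> bounded_ops M \<Longrightarrow> x \<in> M \<Longrightarrow> F (- x) = - F x"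
  by (simp only: minus_eq_scaleC op_scaleC)

lemma op_bound:
  assumes "F \<in> bounded_ops M"
  obtains K where "K > 0" "\<And>x. x \<in> M \<Longrightarrow> norm (F x) \<le> K * norm x"
proof -
  obtain K where K: "\<And>x. x \<in> M \<Longrightarrow> norm (F x) \<le> K * norm x"
    using assms by (auto simp: bounded_ops_def)
  have "norm (F x) \<le> (\<bar>K\<bar> + 1) * norm x" if "x \<in> M" for x
    using K[OF that] by (rule order_trans) (simp add: mult_right_mono)
  then show thesis using that[of "\<bar>K\<bar> + 1"] by simp
qed

lemma op_eqI:
  "F \<in> bounded_ops M \<Longrightarrow> G \<in> bounded_ops M \<Longrightarrow> (\<And>x. x \<in> M \<Longrightarrow> F x = G x) \<Longrightarrow> F = G"
  by (auto simp: bounded_ops_def intro: PiE_ext)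

lemma restrict_in_bounded_ops:
  assumes "\<And>x. x \<in> M \<Longrightarrow> F x \<in> M"
    and "\<And>x y. x \<in> M \<Longrightarrow> y \<in> M \<Longrightarrow> F (x + y) = F x + F y"
    and "\<And>c x. x \<in> M \<Longrightarrow> F (c *\<^sub>C x) = c *\<^sub>C F x"
    and "\<And>x. x \<in> M \<Longrightarrow> norm (F x) \<le> K * norm x"
  shows "restrict F M \<in> bounded_ops M"
  using assms by (auto simp: bounded_ops_def clinear_on_def intro: exI[of _ K])

lemma restrict_op: "F \<in> bounded_ops M \<Longrightarrow> restrict F M = F"
  by (auto simp: bounded_ops_def PiE_restrict)

lemma op_restrict_subspace:
  assumes F: "F \<in> bounded_ops M" and N: "closed_csubspace N" "N \<subseteq> M"
    and maps: "\<And>x. x \<in> N \<Longrightarrow> F x \<in> N"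
  shows "restrict F N \<in> bounded_ops N"
proof -
  obtain K where "K > 0" "\<And>x. x \<in> M \<Longrightarrow> norm (F x) \<le> K * norm x"
    using op_bound[OF F] by blast
  then show ?thesis
    using N(2) by (intro closed_csubspace.restrict_in_bounded_ops[OF N(1), where K = K] maps)
      (auto simp: op_add[OF F] op_scaleC[OF F] subset_iff)
qed

lemma scale_op: "F \<in> bounded_ops M \<Longrightarrow> (\<lambda>x\<in>M. c *\<^sub>C F x) \<in> bounded_ops M"
proof -
  assume F: "F \<in> bounded_ops M"
  obtain K where K: "K > 0" "\<And>x. x \<in> M \<Longrightarrow> norm (F x) \<le> K * norm x"
    using op_bound[OF F] by blast
  show ?thesis
  proof (rule restrict_in_bounded_ops)
    show "norm (c *\<^sub>C F x) \<le> (cmod c * K) * norm x" if "x \<in> M" for x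
      using K(2)[OF that] by (simp add: norm_scaleC mult_left_mono mult.assoc)
  qed (simp_all add: F op_add op_scaleC scaleC_add_right scaleC_scaleC mult.commute)
qed

lemma id_op: "(\<lambda>x\<in>M. x) \<in> bounded_ops M"
  by (rule restrict_in_bounded_ops[where K = 1]) auto

lemma const_op: "(\<lambda>x\<in>M. c *\<^sub>C x) \<in> bounded_ops M"
proof -
  have "(\<lambda>x\<in>M. c *\<^sub>C x) = (\<lambda>x\<in>M. c *\<^sub>C (\<lambda>x\<in>M. x) x)" by (rule restrict_ext) simp
  then show ?thesis using scale_op[OF id_op] by simp
qed

lemma add_op:
  assumes F: "F \<in> bounded_ops M" and G: "G \<in> bounded_ops M"
  shows "(\<lambda>x\<in>M. F x + G x) \<in> bounded_ops M"
proof -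
  obtain K where K: "K > 0" "\<And>x. x \<in> M \<Longrightarrow> norm (F x) \<le> K * norm x"
    using op_bound[OF F] by blast
  obtain L where L: "L > 0" "\<And>x. x \<in> M \<Longrightarrow> norm (G x) \<le> L * norm x"
    using op_bound[OF G] by blast
  show ?thesis
  proof (rule restrict_in_bounded_ops)
    show "norm (F x + G x) \<le> (K + L) * norm x" if "x \<in> M" for x
      using norm_triangle_ineq[of "F x" "G x"] K(2)[OF that] L(2)[OF that] by (simp add: distrib_right)
  qed (simp_all add: F G op_add op_scaleC scaleC_add_right)
qed

lemma diff_op:
  assumes F: "F \<in> bounded_ops M" and G: "G \<in> bounded_ops M"
  shows "(\<lambda>x\<in>M. F x - G x) \<in> bounded_ops M"
proof -
  have "(\<lambda>x\<in>M. F x - G x) = (\<lambda>x\<in>M. F x + (\<lambda>x\<in>M. (-1) *\<^sub>C G x) x)"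
    by (rule restrict_ext) (simp add: minus_eq_scaleC[symmetric])
  then show ?thesis using add_op[OF F scale_op[OF G, of "-1"]] by simp
qed

lemma compose_op:
  assumes F: "F \<in> bounded_ops M" and G: "G \<in> bounded_ops M"
  shows "compose M F G \<in> bounded_ops M"
proof -
  obtain K where K: "K > 0" "\<And>x. x \<in> M \<Longrightarrow> norm (F x) \<le> K * norm x"
    using op_bound[OF F] by blast
  obtain L where L: "L > 0" "\<And>x. x \<in> M \<Longrightarrow> norm (G x) \<le> L * norm x"
    using op_bound[OF G] by blast
  show ?thesis
    unfolding compose_def
  proof (rule restrict_in_bounded_ops)
    show "norm (F (G x)) \<le> (K * L) * norm x" if "x \<in> M" for x
    proof -
      have "norm (F (G x)) \<le> K * norm (G x)" using K(2) G that by simp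
      also have "\<dots> \<le> K * (L * norm x)" using K(1) L(2)[OF that] by simp
      finally show ?thesis by simp
    qed
  qed (simp_all add: F G op_add op_scaleC)
qed

text \<open>As an operator on the larger space N, the projection can be used in
  \<open>calc_commute\<close>; this is how the calculus on \<open>H \<beta>\<close> is seen to
  commute with the projection onto \<open>H \<alpha>\<close>.\<close>

lemma orth_proj_op: "(\<lambda>x\<in>N. orth_proj M x) \<in> bounded_ops N"
  if "closed_csubspace N" "M \<subseteq> N" for N
proof -
  interpret N: closed_csubspace N by fact
  show ?thesis
    using that(2) by (intro N.restrict_in_bounded_ops[where K = 1])
      (auto simp: orth_proj_add orth_proj_scaleC norm_orth_proj_le)
qed

section \<open>Adjoints and the operator norm\<close>

lemma op_adjoint_exists:
  assumes F: "F \<in> bounded_ops M"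
  shows "\<exists>!B. B \<in> bounded_ops M \<and> (\<forall>x\<in>M. \<forall>y\<in>M. cinner (F x) y = cinner x (B y))"
proof -
  obtain K where K: "K > 0" "\<And>x. x \<in> M \<Longrightarrow> norm (F x) \<le> K * norm x"
    using op_bound[OF F] by blast
  have "\<exists>z\<in>M. \<forall>x\<in>M. inner (F x) y = inner x z" if "y \<in> M" for y
    using csubspace_imp_subspace[OF csub] closedM
  proof (rule Riesz_on_closed_subspace)
    show "\<bar>inner (F x) y\<bar> \<le> (K * norm y) * norm x" if "x \<in> M" for x
    proof -
      have "\<bar>inner (F x) y\<bar> \<le> norm (F x) * norm y" by (rule Cauchy_Schwarz_ineq2)
      also have "\<dots> \<le> K * norm x * norm y"
        using K(2)[OF that] by (simp add: mult_right_mono)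
      finally show ?thesis by (simp add: algebra_simps)
    qed
  qed (simp_all add: F op_add op_scaleR inner_add_left)
  then obtain B where B: "\<And>y. y \<in> M \<Longrightarrow> B y \<in> M"
      "\<And>x y. x \<in> M \<Longrightarrow> y \<in> M \<Longrightarrow> inner (F x) y = inner x (B y)"
    by metis
  \<comment> \<open>Riesz gives only the real part of the identity; testing with i x gives the
    imaginary part.\<close>
  have cB: "cinner (F x) y = cinner x (B y)" if "x \<in> M" "y \<in> M" for x y
    using B(2)[OF that] B(2)[of "\<i> *\<^sub>C x" y] that
    by (simp add: complex_eq_iff Im_cinner op_scaleC F) (simp add: inner_eq_Re_cinner)
  have "restrict B M \<in> bounded_ops M"
  proof (rule restrict_in_bounded_ops)
    show "B (x + y) = B x + B y" if "x \<in> M" "y \<in> M" for x y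
      using that by (intro eq_if_cinner_eq) (auto simp: B(1) cinner_add_right simp flip: cB)
    show "B (c *\<^sub>C x) = c *\<^sub>C B x" if "x \<in> M" for c x
      using that by (intro eq_if_cinner_eq) (auto simp: B(1) cinner_scaleC_right simp flip: cB)
    show "norm (B x) \<le> K * norm x" if x: "x \<in> M" for x
    proof (cases "norm (B x) = 0")
      case False
      \<comment> \<open>Pairing B x with itself moves one factor back through F, so the bound K of F
        also bounds B.\<close>
      have "norm (B x) * norm (B x) = inner (F (B x)) x"
        using B x by (simp add: dot_square_norm power2_eq_square)
      also have "\<dots> \<le> norm (F (B x)) * norm x" by (rule norm_cauchy_schwarz)
      also have "\<dots> \<le> K * norm (B x) * norm x"
        using K(2)[OF B(1)[OF x]] by (simp add: mult_right_mono)
      finally show ?thesis using False by (simp add: mult.assoc mult.left_commute)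
    qed (use K in simp)
  qed (simp add: B)
  moreover have "B' = B''" if "B' \<in> bounded_ops M \<and> (\<forall>x\<in>M. \<forall>y\<in>M. cinner (F x) y = cinner x (B' y))"
      "B'' \<in> bounded_ops M \<and> (\<forall>x\<in>M. \<forall>y\<in>M. cinner (F x) y = cinner x (B'' y))" for B' B''
    using that by (intro op_eqI eq_if_cinner_eq) auto
  ultimately show ?thesis
    using cB by (intro ex_ex1I exI[of _ "restrict B M"]) auto
qed

lemma op_adjoint_op [simp]: "F \<in> bounded_ops M \<Longrightarrow> op_adjoint M F \<in> bounded_ops M"
  and cinner_op_adjoint:
    "F \<in> bounded_ops M \<Longrightarrow> x \<in> M \<Longrightarrow> y \<in> M \<Longrightarrow> cinner (F x) y = cinner x (op_adjoint M F y)"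
  using theI'[OF op_adjoint_exists[of F]] unfolding op_adjoint_def by auto

lemma op_adjointI:
  "F \<in> bounded_ops M \<Longrightarrow> B \<in> bounded_ops M \<Longrightarrow>
    (\<And>x y. x \<in> M \<Longrightarrow> y \<in> M \<Longrightarrow> cinner (F x) y = cinner x (B y)) \<Longrightarrow> op_adjoint M F = B"
  unfolding op_adjoint_def by (rule the1_equality[OF op_adjoint_exists]) auto

lemma cinner_op_adjoint':
  "F \<in> bounded_ops M \<Longrightarrow> x \<in> M \<Longrightarrow> y \<in> M \<Longrightarrow> cinner (op_adjoint M F x) y = cinner x (F y)"
  by (metis cinner_commute cinner_op_adjoint)

lemma inner_op_adjoint:
  "F \<in> bounded_ops M \<Longrightarrow> x \<in> M \<Longrightarrow> y \<in> M \<Longrightarrow> inner (F x) y = inner x (op_adjoint M F y)"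
  "F \<in> bounded_ops M \<Longrightarrow> x \<in> M \<Longrightarrow> y \<in> M \<Longrightarrow> inner (op_adjoint M F x) y = inner x (F y)"
  by (simp_all only: inner_eq_Re_cinner cinner_op_adjoint[symmetric] cinner_op_adjoint')

lemma op_adjoint_adjoint: "F \<in> bounded_ops M \<Longrightarrow> op_adjoint M (op_adjoint M F) = F"
  by (rule op_adjointI) (simp_all add: cinner_op_adjoint')

lemma op_adjoint_const: "op_adjoint M (\<lambda>x\<in>M. c *\<^sub>C x) = (\<lambda>x\<in>M. cnj c *\<^sub>C x)"
  by (rule op_adjointI) (simp_all add: const_op cinner_scaleC_left cinner_scaleC_right)

lemma op_adjoint_add:
  "F \<in> bounded_ops M \<Longrightarrow> G \<in> bounded_ops M \<Longrightarrow>
    op_adjoint M (\<lambda>x\<in>M. F x + G x) = (\<lambda>x\<in>M. op_adjoint M F x + op_adjoint M G x)"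
  by (rule op_adjointI) (simp_all add: add_op cinner_add_left cinner_add_right cinner_op_adjoint)

lemma op_adjoint_diff:
  "F \<in> bounded_ops M \<Longrightarrow> G \<in> bounded_ops M \<Longrightarrow>
    op_adjoint M (\<lambda>x\<in>M. F x - G x) = (\<lambda>x\<in>M. op_adjoint M F x - op_adjoint M G x)"
  by (rule op_adjointI) (simp_all add: diff_op cinner_diff_left cinner_diff_right cinner_op_adjoint)

lemma op_adjoint_compose:
  "F \<in> bounded_ops M \<Longrightarrow> G \<in> bounded_ops M \<Longrightarrow>
    op_adjoint M (compose M F G) = compose M (op_adjoint M G) (op_adjoint M F)"
  by (rule op_adjointI) (simp_all add: compose_op compose_eq cinner_op_adjoint)

lemma op_adjoint_bound:
  assumes F: "F \<in> bounded_ops M" and K: "\<And>x. x \<in> M \<Longrightarrow> norm (F x) \<le> K * norm x"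
    and x: "x \<in> M"
  shows "norm (op_adjoint M F x) \<le> K * norm x"
proof (cases "norm (op_adjoint M F x) = 0")
  case True
  have "0 \<le> K * norm x" using K[OF x] by (metis norm_ge_zero order_trans)
  with True show ?thesis by simp
next
  case False
  let ?y = "op_adjoint M F x"
  have y: "?y \<in> M" using F x by simp
  have "norm ?y * norm ?y = inner (F ?y) x"
    using inner_op_adjoint(1)[OF F y x] by (simp add: dot_square_norm power2_eq_square)
  also have "\<dots> \<le> norm (F ?y) * norm x" by (rule norm_cauchy_schwarz)
  also have "\<dots> \<le> K * norm ?y * norm x"
    using K[OF y] by (simp add: mult_right_mono)
  finally show ?thesis using False by (simp add: mult.assoc mult.left_commute)
qed

text \<open>If \<open>x = 0\<close>, then \<open>norm (F x) / norm x = 0\<close>.\<close>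

lemma op_norm_eqI:
  assumes K: "\<And>x. x \<in> M \<Longrightarrow> norm (F x) \<le> K * norm x" and "K \<ge> 0"
    and least: "\<And>L. L \<ge> 0 \<Longrightarrow> (\<And>x. x \<in> M \<Longrightarrow> norm (F x) \<le> L * norm x) \<Longrightarrow> K \<le> L"
  shows "op_norm M F = K"
proof -
  have le: "norm (F x) / norm x \<le> K" if "x \<in> M" for x
    using K[OF that] \<open>K \<ge> 0\<close> by (cases "norm x = 0") (auto simp: divide_le_eq)
  have bdd: "bdd_above ((\<lambda>x. norm (F x) / norm x) ` M)"
    using le by (intro bdd_aboveI2)
  show ?thesis
    unfolding op_norm_def
  proof (rule antisym)
    show "(SUP x\<in>M. norm (F x) / norm x) \<le> K"
      by (rule cSUP_least[OF _ le]) (use zero_mem in blast)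
    show "K \<le> (SUP x\<in>M. norm (F x) / norm x)"
    proof (rule least)
      show "0 \<le> (SUP x\<in>M. norm (F x) / norm x)"
        using cSUP_upper[OF zero_mem bdd] by simp
      show "norm (F x) \<le> (SUP x\<in>M. norm (F x) / norm x) * norm x" if "x \<in> M" for x
        using cSUP_upper[OF that bdd] K[OF that]
        by (cases "norm x = 0") (auto simp: pos_divide_le_eq)
    qed
  qed
qed

lemma op_norm_bound:
  assumes F: "F \<in> bounded_ops M" and x: "x \<in> M"
  shows "norm (F x) \<le> op_norm M F * norm x"
proof -
  obtain K where K: "K > 0" "\<And>x. x \<in> M \<Longrightarrow> norm (F x) \<le> K * norm x"
    using op_bound[OF F] by blast
  have "bdd_above ((\<lambda>x. norm (F x) / norm x) ` M)"
    using K by (intro bdd_aboveI2[where M = K]) (auto simp: divide_le_eq)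
  then have "norm (F x) / norm x \<le> op_norm M F"
    unfolding op_norm_def by (intro cSUP_upper x)
  with K(2)[OF x] show ?thesis
    by (cases "norm x = 0") (auto simp: pos_divide_le_eq)
qed

section \<open>Normal operators: spectrum and approximate eigenvalues\<close>

definition normal_op :: "('a \<Rightarrow> 'a) \<Rightarrow> bool" where
  "normal_op F \<longleftrightarrow> F \<in> bounded_ops M \<and> (\<forall>x\<in>M. F (op_adjoint M F x) = op_adjoint M F (F x))"

lemma normal_op_bounded [simp]: "normal_op F \<Longrightarrow> F \<in> bounded_ops M"
  by (simp add: normal_op_def)

text \<open>Normality gives F and its adjoint equal norms on x, and the cross terms agree by
  adjointness. Hence approximate eigenvectors of F for l are approximate eigenvectors of the adjoint
  for the conjugate of l.\<close>

lemma norm_adjoint_normal: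
  assumes "normal_op F" "x \<in> M"
  shows "norm (op_adjoint M F x - cnj l *\<^sub>C x) = norm (F x - l *\<^sub>C x)"
proof -
  have F: "F \<in> bounded_ops M" and n: "F (op_adjoint M F x) = op_adjoint M F (F x)"
    using assms by (auto simp: normal_op_def)
  have "cinner (op_adjoint M F x) (op_adjoint M F x) = cinner (F x) (F x)"
    using cinner_op_adjoint'[OF F assms(2), of "op_adjoint M F x"] cinner_op_adjoint[OF F assms(2), of "F x"] n F assms(2)
    by simp
  moreover have "cinner (op_adjoint M F x) x = cinner x (F x)" "cinner x (op_adjoint M F x) = cinner (F x) x"
    by (simp_all only: cinner_op_adjoint'[OF F assms(2,2)] cinner_op_adjoint[OF F assms(2,2)])
  ultimately have "cinner (op_adjoint M F x - cnj l *\<^sub>C x) (op_adjoint M F x - cnj l *\<^sub>C x) =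
      cinner (F x - l *\<^sub>C x) (F x - l *\<^sub>C x)"
    by (simp add: cinner_diff_left cinner_diff_right cinner_scaleC_left cinner_scaleC_right algebra_simps)
  then show ?thesis
    by (simp add: cinner_self power2_eq_iff_nonneg flip: of_real_power)
qed

text \<open>A left inverse of l - F with bound K would keep the norm of (l - F) x at or above 1/K on
  unit vectors.\<close>

lemma spectrum_of_approx_eigenvector:
  assumes F: "F \<in> bounded_ops M"
    and approx: "\<And>e. e > 0 \<Longrightarrow> \<exists>x\<in>M. norm x = 1 \<and> norm (F x - l *\<^sub>C x) < e"
  shows "l \<in> op_spectrum M F"
proof (rule ccontr)
  assume "l \<notin> op_spectrum M F"
  then obtain B where B: "B \<in> bounded_ops M"
      and BL: "compose M B (\<lambda>x\<in>M. l *\<^sub>C x - F x) = (\<lambda>x\<in>M. x)"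
    by (auto simp: op_spectrum_def spectrum_in_def invertible_in_def)
  obtain K where K: "K > 0" "\<And>x. x \<in> M \<Longrightarrow> norm (B x) \<le> K * norm x"
    using op_bound[OF B] by blast
  obtain x where x: "x \<in> M" "norm x = 1" "norm (F x - l *\<^sub>C x) < 1 / K"
    using approx[of "1 / K"] K(1) by auto
  have "x = B (l *\<^sub>C x - F x)"
    using fun_cong[OF BL, of x] x(1) by (simp add: compose_eq)
  then have "1 \<le> K * norm (l *\<^sub>C x - F x)"
    using K(2)[of "l *\<^sub>C x - F x"] x F by simp
  then show False
    using x(3) K(1) by (simp add: norm_minus_commute pos_less_divide_eq mult.commute)
qed

lemma op_invertibleI:
  assumes F: "F \<in> bounded_ops M" and l: "l \<notin> op_spectrum M F"
  obtains B where "B \<in> bounded_ops M" "\<And>x. x \<in> M \<Longrightarrow> B (l *\<^sub>C x - F x) = x"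
    "\<And>x. x \<in> M \<Longrightarrow> l *\<^sub>C B x - F (B x) = x"
proof -
  obtain B where B: "B \<in> bounded_ops M"
      and 1: "compose M B (\<lambda>x\<in>M. l *\<^sub>C x - F x) = (\<lambda>x\<in>M. x)"
      and 2: "compose M (\<lambda>x\<in>M. l *\<^sub>C x - F x) B = (\<lambda>x\<in>M. x)"
    using l by (auto simp: op_spectrum_def spectrum_in_def invertible_in_def)
  show thesis
  proof (rule that[OF B])
    show "B (l *\<^sub>C x - F x) = x" "l *\<^sub>C B x - F (B x) = x" if "x \<in> M" for x
      using fun_cong[OF 1, of x] fun_cong[OF 2, of x] that B by (simp_all add: compose_eq)
  qed
qed

lemma not_in_op_spectrumI:
  assumes F: "F \<in> bounded_ops M" and B: "B \<in> bounded_ops M"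
    and 1: "\<And>x. x \<in> M \<Longrightarrow> B (l *\<^sub>C x - F x) = x"
    and 2: "\<And>x. x \<in> M \<Longrightarrow> l *\<^sub>C B x - F (B x) = x"
  shows "l \<notin> op_spectrum M F"
proof -
  have "(\<lambda>x\<in>M. l *\<^sub>C x - F x) = (\<lambda>x\<in>M. (\<lambda>x\<in>M. l *\<^sub>C x) x - F x)"
    by (rule restrict_ext) simp
  then have "(\<lambda>x\<in>M. l *\<^sub>C x - F x) \<in> bounded_ops M"
    using diff_op[OF const_op F] by simp
  moreover have "compose M B (\<lambda>x\<in>M. l *\<^sub>C x - F x) = (\<lambda>x\<in>M. x)"
    "compose M (\<lambda>x\<in>M. l *\<^sub>C x - F x) B = (\<lambda>x\<in>M. x)"
    using 1 2 B by (auto simp: compose_def intro!: restrict_ext)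
  ultimately show ?thesis
    using B by (auto simp: op_spectrum_def spectrum_in_def invertible_in_def)
qed

text \<open>Otherwise l - F is bounded below by e, hence injective with closed range. The orthogonal
  complement of the range is the kernel of the adjoint, which by normality is the kernel of l - F
  and so zero. The inverse then exists with bound 1/e.\<close>

lemma approx_eigenvector_of_spectrum:
  assumes n: "normal_op F" and l: "l \<in> op_spectrum M F" and "e > 0"
  shows "\<exists>x\<in>M. norm x = 1 \<and> norm (F x - l *\<^sub>C x) < e"
proof (rule ccontr)
  assume neg: "\<not> ?thesis"
  have F: "F \<in> bounded_ops M" using n by simp
  define L where "L = (\<lambda>x. l *\<^sub>C x - F x)"
  have Lm: "L x \<in> M" if "x \<in> M" for x using F that by (simp add: L_def)
  have Ladd: "L (x + y) = L x + L y" if "x \<in> M" "y \<in> M" for x y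
    using F that by (simp add: L_def op_add scaleC_add_right)
  have Ldiff: "L (x - y) = L x - L y" if "x \<in> M" "y \<in> M" for x y
    using Ladd[of "x - y" y] that by simp
  have Lsc: "L (c *\<^sub>C x) = c *\<^sub>C L x" if "x \<in> M" for c x
    using F that by (simp add: L_def op_scaleC complex_vector.scale_right_diff_distrib scaleC_scaleC mult.commute)
  have below: "e * norm x \<le> norm (L x)" if x: "x \<in> M" for x
  proof (cases "x = 0")
    case False
    let ?y = "(1 / norm x) *\<^sub>R x"
    have "norm (F ?y - l *\<^sub>C ?y) \<ge> e"
      using neg x False by (force simp: not_less)
    moreover have "norm (F ?y - l *\<^sub>C ?y) = norm (L ?y)"
      by (simp add: L_def norm_minus_commute)
    moreover have "L ?y = (1 / norm x) *\<^sub>R L x"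
      using Lsc[OF x] by (simp add: scaleR_scaleC)
    ultimately show ?thesis using False by (simp add: field_simps)
  qed simp
  have L0: "L 0 = 0" using F op_scaleC[of F 0 0] by (simp add: L_def)
  have sub: "complex_vector.subspace (L ` M)"
    unfolding complex_vector.subspace_def
  proof (intro conjI ballI allI)
    show "0 \<in> L ` M" using L0 zero_mem by (metis imageI)
    show "u + v \<in> L ` M" if "u \<in> L ` M" "v \<in> L ` M" for u v
      using that by (auto simp flip: Ladd)
    show "c *\<^sub>C u \<in> L ` M" if "u \<in> L ` M" for c u
      using that by (auto simp flip: Lsc)
  qed
  have "complete (L ` M)"
    unfolding complete_def
  proof (intro allI impI)
    fix u assume u: "(\<forall>n. u n \<in> L ` M) \<and> Cauchy u"
    then have "\<forall>n. \<exists>w. w \<in> M \<and> u n = L w" by blast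
    then obtain v where v: "\<And>n. v n \<in> M" "\<And>n. u n = L (v n)"
      by metis
    have "Cauchy v"
      unfolding Cauchy_iff
    proof (intro allI impI)
      fix d :: real assume "d > 0"
      then obtain N where N: "\<And>m n. m \<ge> N \<Longrightarrow> n \<ge> N \<Longrightarrow> norm (u m - u n) < e * d"
        using u \<open>e > 0\<close> unfolding Cauchy_iff by (metis mult_pos_pos)
      have "norm (v m - v n) < d" if "m \<ge> N" "n \<ge> N" for m n
      proof -
        have "e * norm (v m - v n) < e * d"
          using below[of "v m - v n"] N[OF that] v by (simp add: Ldiff)
        then show ?thesis using \<open>e > 0\<close> by simp
      qed
      then show "\<exists>N. \<forall>m\<ge>N. \<forall>n\<ge>N. norm (v m - v n) < d" by blast
    qed
    then obtain y where y: "v \<longlonglongrightarrow> y"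
      using Cauchy_convergent convergent_def by blast
    have yM: "y \<in> M" using closed_sequentially[OF closedM] v(1) y by blast
    obtain K where K: "K > 0" "\<And>x. x \<in> M \<Longrightarrow> norm (F x) \<le> K * norm x"
      using op_bound[OF F] by blast
    have "u \<longlonglongrightarrow> L y"
    proof (rule LIM_zero_cancel, rule Lim_null_comparison)
      have "norm (u n - L y) \<le> (cmod l + K) * norm (v n - y)" for n
      proof -
        have "norm (u n - L y) = norm (L (v n - y))" using v yM by (simp add: Ldiff)
        also have "\<dots> \<le> norm (l *\<^sub>C (v n - y)) + norm (F (v n - y))"
          unfolding L_def by (rule norm_triangle_ineq4)
        also have "\<dots> \<le> (cmod l + K) * norm (v n - y)"
          using K(2)[of "v n - y"] v yM by (simp add: norm_scaleC distrib_right)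
        finally show ?thesis .
      qed
      then show "\<forall>\<^sub>F n in sequentially. norm (u n - L y) \<le> (cmod l + K) * norm (v n - y)"
        by simp
      show "(\<lambda>n. (cmod l + K) * norm (v n - y)) \<longlonglongrightarrow> 0"
        using tendsto_mult_right_zero[OF tendsto_norm_zero[OF LIM_zero[OF y]]] .
    qed
    then show "\<exists>l\<in>L ` M. u \<longlonglongrightarrow> l" using yM by blast
  qed
  then interpret R: closed_csubspace "L ` M"
    by (intro closed_csubspace.intro sub complete_imp_closed)
  have surj: "y \<in> L ` M" if y: "y \<in> M" for y
  proof -
    \<comment> \<open>The component of y orthogonal to the range; showing w = 0 puts y into the
      range.\<close>
    define w where "w = y - orth_proj (L ` M) y"
    have "L ` M \<subseteq> M" using Lm by blast
    then have "orth_proj (L ` M) y \<in> M" using R.orth_proj_mem by (rule subsetD)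
    then have wM: "w \<in> M" using y by (simp add: w_def)
    have "cinner (cnj l *\<^sub>C w - op_adjoint M F w) z = 0" if z: "z \<in> M" for z
    proof -
      have "cinner w (L z) = 0" unfolding w_def using z by (intro R.orth_proj_orth) auto
      then show ?thesis
        using F wM z by (simp add: L_def cinner_diff_left cinner_diff_right cinner_scaleC_left
            cinner_scaleC_right cinner_op_adjoint')
    qed
    then have "cinner (cnj l *\<^sub>C w - op_adjoint M F w) (cnj l *\<^sub>C w - op_adjoint M F w) = 0"
      using F wM by simp
    then have "norm (op_adjoint M F w - cnj l *\<^sub>C w) = 0"
      by (simp add: cinner_self)
    then have "norm (L w) = 0"
      using norm_adjoint_normal[OF n wM, of l] by (simp add: L_def)
    then have "e * norm w \<le> 0" using below[OF wM] by simp
    then have "w = 0" using \<open>e > 0\<close> by (simp add: mult_le_0_iff)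
    then show ?thesis using R.orth_proj_mem[of y] by (simp add: w_def)
  qed
  then have "\<forall>y\<in>M. \<exists>x. x \<in> M \<and> L x = y" by blast
  then obtain B where B: "\<And>y. y \<in> M \<Longrightarrow> B y \<in> M" "\<And>y. y \<in> M \<Longrightarrow> L (B y) = y"
    by metis
  have inj: "x = y" if "x \<in> M" "y \<in> M" "L x = L y" for x y
  proof -
    have "e * norm (x - y) \<le> 0" using below[of "x - y"] that by (simp add: Ldiff)
    then show ?thesis using \<open>e > 0\<close> by (simp add: mult_le_0_iff)
  qed
  have Bop: "restrict B M \<in> bounded_ops M"
  proof (rule restrict_in_bounded_ops)
    show "B (x + y) = B x + B y" if "x \<in> M" "y \<in> M" for x y
      by (rule inj) (use that in \<open>auto simp: B Ladd\<close>)
    show "B (c *\<^sub>C x) = c *\<^sub>C B x" if "x \<in> M" for c x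
      by (rule inj) (use that in \<open>auto simp: B Lsc\<close>)
    show "norm (B x) \<le> (1 / e) * norm x" if "x \<in> M" for x
      using below[OF B(1)[OF that]] B(2)[OF that] \<open>e > 0\<close> by (simp add: field_simps)
  qed (simp add: B)
  have "l \<notin> op_spectrum M F"
  proof (rule not_in_op_spectrumI[OF F Bop])
    fix x assume x: "x \<in> M"
    show "l *\<^sub>C restrict B M x - F (restrict B M x) = x"
      using B(2)[OF x] x by (simp add: L_def)
    have "B (L x) = x" by (rule inj) (use x in \<open>auto simp: B Lm\<close>)
    then show "restrict B M (l *\<^sub>C x - F x) = x"
      using Lm[OF x] by (simp add: L_def)
  qed
  with l show False by blast
qed

text \<open>An approximate eigenvector on the unit sphere bounds its eigenvalue by the bound of F,
  and one for a nearby spectral value serves for the limit too. Compactness is what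
  Stone-Weierstrass asks for.\<close>

lemma normal_op_spectrum_compact:
  assumes n: "normal_op F"
  shows "compact (op_spectrum M F)"
proof -
  have F: "F \<in> bounded_ops M" using n by simp
  obtain K where K: "K > 0" "\<And>x. x \<in> M \<Longrightarrow> norm (F x) \<le> K * norm x"
    using op_bound[OF F] by blast
  have "cmod l \<le> K" if l: "l \<in> op_spectrum M F" for l
  proof (rule field_le_epsilon)
    fix e :: real assume "e > 0"
    then obtain x where x: "x \<in> M" "norm x = 1" "norm (F x - l *\<^sub>C x) < e"
      using approx_eigenvector_of_spectrum[OF n l] by blast
    have "cmod l = norm (l *\<^sub>C x)" using x by (simp add: norm_scaleC)
    also have "\<dots> \<le> norm (F x) + norm (F x - l *\<^sub>C x)"
      using norm_triangle_ineq4[of "F x" "F x - l *\<^sub>C x"] by simp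
    also have "\<dots> \<le> K + e" using K(2)[OF x(1)] x by simp
    finally show "cmod l \<le> K + e" .
  qed
  then have "bounded (op_spectrum M F)" unfolding bounded_iff by blast
  moreover have "closed (op_spectrum M F)"
    unfolding closed_sequential_limits
  proof (intro allI impI)
    fix s l assume s: "(\<forall>n. s n \<in> op_spectrum M F) \<and> s \<longlonglongrightarrow> l"
    show "l \<in> op_spectrum M F"
    proof (rule spectrum_of_approx_eigenvector[OF F])
      fix e :: real assume "e > 0"
      then have "\<forall>\<^sub>F n in sequentially. dist (s n) l < e/2"
        using s by (intro tendstoD) auto
      then obtain n where n': "dist (s n) l < e/2"
        unfolding eventually_sequentially by blast
      obtain x where x: "x \<in> M" "norm x = 1" "norm (F x - s n *\<^sub>C x) < e/2"
        using approx_eigenvector_of_spectrum[OF n, of "s n" "e/2"] s \<open>e > 0\<close> by auto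
      have "F x - l *\<^sub>C x = (F x - s n *\<^sub>C x) + (s n - l) *\<^sub>C x"
        by (simp add: complex_vector.scale_left_diff_distrib)
      then have "norm (F x - l *\<^sub>C x) \<le> norm (F x - s n *\<^sub>C x) + norm ((s n - l) *\<^sub>C x)"
        by (metis norm_triangle_ineq)
      also have "\<dots> < e" using x n' by (simp add: norm_scaleC dist_norm)
      finally show "\<exists>x\<in>M. norm x = 1 \<and> norm (F x - l *\<^sub>C x) < e" using x by blast
    qed
  qed
  ultimately show ?thesis by (simp add: compact_eq_bounded_closed)
qed

section \<open>Joint approximate eigenvectors\<close>

text \<open>Positivity of the form at x - P x / K, with the bound K inserted for the term quadratic
  in P x. It makes a unit vector on which the form is small an approximate null vector of P.\<close>

lemma positive_op_bound:
  assumes P: "P \<in> bounded_ops M"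
    and sym: "\<And>x y. x \<in> M \<Longrightarrow> y \<in> M \<Longrightarrow> inner (P x) y = inner x (P y)"
    and pos: "\<And>x. x \<in> M \<Longrightarrow> 0 \<le> inner (P x) x"
    and K: "K > 0" "\<And>x. x \<in> M \<Longrightarrow> norm (P x) \<le> K * norm x"
    and x: "x \<in> M"
  shows "(norm (P x))\<^sup>2 \<le> K * inner (P x) x"
proof -
  let ?y = "P x"
  have y: "?y \<in> M" using P x by simp
  have "0 \<le> inner (P (x - (1/K) *\<^sub>R ?y)) (x - (1/K) *\<^sub>R ?y)"
    using pos x y by simp
  also have "\<dots> = inner ?y x - 2 / K * (norm ?y)\<^sup>2 + inner (P ?y) ?y / K\<^sup>2"
    using x y sym[OF y x]
    by (simp add: op_diff[OF P] op_scaleR[OF P] inner_diff_left inner_diff_right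
        power2_norm_eq_inner)
      (simp add: power2_eq_square algebra_simps diff_divide_distrib)
  also have "inner (P ?y) ?y \<le> K * (norm ?y)\<^sup>2"
  proof -
    have "inner (P ?y) ?y \<le> norm (P ?y) * norm ?y" by (rule norm_cauchy_schwarz)
    also have "\<dots> \<le> K * norm ?y * norm ?y" using K(2)[OF y] by (simp add: mult_right_mono)
    finally show ?thesis by (simp add: power2_eq_square)
  qed
  then have "inner (P ?y) ?y / K\<^sup>2 \<le> (norm ?y)\<^sup>2 / K"
    using K(1) by (simp add: field_simps power2_eq_square)
  finally show ?thesis
    using K(1) by (simp add: field_simps)
qed

text \<open>With \<open>C = G\<^sub>1\<^sup>2 + G\<^sub>2\<^sup>2\<close>, an approximate eigenvector of \<open>X - t C\<close> at the top \<open>m t\<close> of its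
  numerical range works once \<open>t\<close> is large: \<open>m\<close> decreases to a limit \<open>r\<close>, and positivity of
  \<open>m (t/2) - X + (t/2) C\<close> and of its product with \<open>C\<close> bound \<open>t C x\<close> by \<open>m (t/2) - m t\<close>.\<close>

lemma joint_approx_eigenvector:
  assumes X: "X \<in> bounded_ops M" and G1: "G1 \<in> bounded_ops M" and G2: "G2 \<in> bounded_ops M"
    and symX: "\<And>x y. x \<in> M \<Longrightarrow> y \<in> M \<Longrightarrow> inner (X x) y = inner x (X y)"
    and sym1: "\<And>x y. x \<in> M \<Longrightarrow> y \<in> M \<Longrightarrow> inner (G1 x) y = inner x (G1 y)"
    and sym2: "\<And>x y. x \<in> M \<Longrightarrow> y \<in> M \<Longrightarrow> inner (G2 x) y = inner x (G2 y)"
    and comm1: "\<And>x. x \<in> M \<Longrightarrow> X (G1 x) = G1 (X x)"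
    and comm2: "\<And>x. x \<in> M \<Longrightarrow> X (G2 x) = G2 (X x)"
    and comm12: "\<And>x. x \<in> M \<Longrightarrow> G1 (G2 x) = G2 (G1 x)"
    and approx: "\<And>e. e > 0 \<Longrightarrow> \<exists>x\<in>M. norm x = 1 \<and> norm (G1 x) < e \<and> norm (G2 x) < e"
  shows "\<exists>r::real. \<forall>e>0. \<exists>x\<in>M. norm x = 1 \<and> norm (G1 x) < e \<and> norm (G2 x) < e \<and>
    norm (X x - r *\<^sub>R x) < e"
proof -
  define C where "C x = G1 (G1 x) + G2 (G2 x)" for x
  define c where "c x = (norm (G1 x))\<^sup>2 + (norm (G2 x))\<^sup>2" for x
  have Cm [simp]: "C x \<in> M" if "x \<in> M" for x using G1 G2 that by (simp add: C_def)
  have c0: "0 \<le> c x" for x by (simp add: c_def)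
  have cC: "inner (C x) x = c x" if "x \<in> M" for x
    using sym1[of "G1 x" x] sym2[of "G2 x" x] G1 G2 that
    by (simp add: C_def c_def inner_add_left power2_norm_eq_inner)
  have csc: "c (a *\<^sub>R x) = a\<^sup>2 * c x" if "x \<in> M" for a x
    using that by (simp add: c_def op_scaleR G1 G2 power_mult_distrib algebra_simps)
  obtain R where R: "R > 0" "\<And>x. x \<in> M \<Longrightarrow> norm (X x) \<le> R * norm x"
    using op_bound[OF X] by blast
  have Cop: "restrict C M \<in> bounded_ops M"
    using add_op[OF compose_op[OF G1 G1] compose_op[OF G2 G2]]
    by (rule back_subst[where P = "\<lambda>F. F \<in> bounded_ops M"])
      (auto simp: C_def compose_def restrict_def)
  obtain KC where KC: "KC > 0" "\<And>x. x \<in> M \<Longrightarrow> norm (C x) \<le> KC * norm x"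
    using op_bound[OF Cop] by (metis restrict_apply')
  define q where "q x = inner (X x) x" for x
  have q: "\<bar>q x\<bar> \<le> R" if "x \<in> M" "norm x = 1" for x
    using Cauchy_Schwarz_ineq2[of "X x" x] R(2)[of x] that by (simp add: q_def)
  define S where "S = {x \<in> M. norm x = 1}"
  have Sne: "S \<noteq> {}" using approx[of 1] by (auto simp: S_def)
  \<comment> \<open>The term t c x penalises vectors away from the approximate kernel of C.\<close>
  define m where "m t = (SUP x\<in>S. q x - t * c x)" for t
  have bdd: "bdd_above ((\<lambda>x. q x - t * c x) ` S)" if "t \<ge> 0" for t
  proof (rule bdd_aboveI2)
    show "q x - t * c x \<le> R" if "x \<in> S" for x
      using q[of x] that mult_nonneg_nonneg[OF \<open>t \<ge> 0\<close> c0[of x]] by (simp add: S_def)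
  qed
  have m_ge: "q x - t * c x \<le> m t" if "t \<ge> 0" "x \<in> S" for t x
    unfolding m_def by (rule cSUP_upper[OF that(2) bdd[OF that(1)]])
  \<comment> \<open>On the common approximate null vectors of G1 and G2 the penalty is negligible
    while q stays above -R, so m cannot decrease without bound.\<close>
  have m_lower: "- R \<le> m t" if t: "t \<ge> 0" for t
  proof (rule field_le_epsilon)
    fix e :: real assume e: "e > 0"
    define d where "d = min 1 (e / (2 * (t + 1)))"
    have d: "0 < d" "d \<le> 1" using e t by (auto simp: d_def)
    have "d \<le> e / (2 * (t + 1))" by (simp add: d_def)
    then have d3: "d * (2 * (t + 1)) \<le> e"
      using t by (simp add: pos_le_divide_eq)
    obtain x where x: "x \<in> M" "norm x = 1" "norm (G1 x) < d" "norm (G2 x) < d"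
      using approx[OF d(1)] by blast
    have sq: "u\<^sup>2 \<le> d" if "0 \<le> u" "u < d" for u :: real
      using mult_mono[of u d u 1] that d by (simp add: power2_eq_square)
    have "c x \<le> 2 * d" using sq[of "norm (G1 x)"] sq[of "norm (G2 x)"] x by (simp add: c_def)
    then have "(t + 1) * c x \<le> (t + 1) * (2 * d)" using t by (intro mult_left_mono) auto
    then have "t * c x \<le> e" using d3 c0[of x] by (simp add: algebra_simps)
    moreover have "q x - t * c x \<le> m t" using m_ge[OF t] x by (simp add: S_def)
    ultimately show "- R \<le> m t + e" using q[OF x(1,2)] by simp
  qed
  have m_anti: "m t \<le> m s" if "0 \<le> s" "s \<le> t" for s t
    unfolding m_def[of t]
  proof (rule cSUP_least[OF Sne])
    show "q x - t * c x \<le> m s" if "x \<in> S" for x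
      using m_ge[OF \<open>0 \<le> s\<close> that] mult_right_mono[OF \<open>s \<le> t\<close> c0[of x]] by simp
  qed
  define r where "r = (INF t\<in>{0..}. m t)"
  have bddm: "bdd_below (m ` {0..})" using m_lower by (intro bdd_belowI2) auto
  define P where "P a t x = a *\<^sub>R x - X x + t *\<^sub>R C x" for a t x
  have Pop: "restrict (P a t) M \<in> bounded_ops M" for a t
    using add_op[OF diff_op[OF const_op X] scale_op[OF Cop], of "of_real a" "of_real t"]
    by (rule back_subst[where P = "\<lambda>F. F \<in> bounded_ops M"])
      (auto simp: P_def restrict_def scaleR_scaleC)
  have Pm [simp]: "P a t x \<in> M" if "x \<in> M" for a t x using that X by (simp add: P_def)
  have symC: "inner (C x) y = inner x (C y)" if "x \<in> M" "y \<in> M" for x y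
    using that G1 G2 by (simp add: C_def inner_add_left inner_add_right sym1 sym2)
  have symP: "inner (P a t x) y = inner x (P a t y)" if "x \<in> M" "y \<in> M" for a t x y
    using that by (simp add: P_def inner_add_left inner_add_right inner_diff_left inner_diff_right symX symC)
  have PG1: "P a t (G1 x) = G1 (P a t x)" if "x \<in> M" for a t x
    using that X G1 G2 by (simp add: P_def C_def op_add op_diff op_scaleR comm1 comm12)
  have PG2: "P a t (G2 x) = G2 (P a t x)" if "x \<in> M" for a t x
    using that X G1 G2 by (simp add: P_def C_def op_add op_diff op_scaleR comm2 comm12)
  have Px: "inner (P a t x) x = a * (norm x)\<^sup>2 - q x + t * c x" if "x \<in> M" for a t x
    using that by (simp add: P_def inner_add_left inner_diff_left cC q_def power2_norm_eq_inner)
  have Ppos: "0 \<le> inner (P (m t) t x) x" if t: "t \<ge> 0" and x: "x \<in> M" for t x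
  proof (cases "x = 0")
    case False
    let ?u = "(1 / norm x) *\<^sub>R x"
    have "?u \<in> S" using x False by (simp add: S_def)
    then have "q ?u - t * c ?u \<le> m t" by (rule m_ge[OF t])
    then have "(q x - t * c x) / (norm x)\<^sup>2 \<le> m t"
      using x by (simp add: q_def op_scaleR[OF X] csc power2_eq_square diff_divide_distrib)
    then show ?thesis using False by (simp add: Px[OF x] pos_divide_le_eq)
  qed simp
  have "\<exists>x\<in>M. norm x = 1 \<and> norm (G1 x) < e \<and> norm (G2 x) < e \<and> norm (X x - r *\<^sub>R x) < e"
    if e: "e > 0" for e
  proof -
    \<comment> \<open>The final estimates are h + 3 h + h for X x - r x and 4 h for c x; they have
      to stay below e and e^2.\<close>
    define h where "h = min (e / 6) (e\<^sup>2 / 8)"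
    have h: "h > 0" "5 * h < e" "4 * h < e\<^sup>2"
      using e by (auto simp: h_def min_def power2_eq_square)
    have "r < r + h" using h by simp
    then obtain s where s: "s \<ge> 0" "m s < r + h"
      using cInf_lessD[of "m ` {0..}" "r + h"] unfolding r_def by auto
    \<comment> \<open>The factor 2 places t/2 beyond s, so that m t and m (t/2) both lie between r
      and r + h. Being at least 2, t also lets a bound on t c x pass to c x.\<close>
    define t where "t = 2 * max s 1"
    have t: "t \<ge> 2" "s \<le> t/2" by (auto simp: t_def)
    have rle: "r \<le> m t" unfolding r_def using bddm t(1) by (intro cINF_lower) auto
    have mm: "m t \<le> m (t/2)" "m (t/2) \<le> m s" using t s by (auto intro!: m_anti)
    obtain K where K: "K > 0" "\<And>x. x \<in> M \<Longrightarrow> norm (P (m t) t x) \<le> K * norm x"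
      using op_bound[OF Pop[of "m t" t]] by (metis restrict_apply')
    \<comment> \<open>With the tolerance d^2/K in the choice of x, \<open>positive_op_bound\<close>
      gives norm at most d for P (m t) t x. The second entry of the minimum makes the error from
      pairing with C x at most h^2 after multiplication by 2 t.\<close>
    define d where "d = min h (h\<^sup>2 / (2 * t * KC))"
    have d: "d > 0" "d \<le> h" "2 * t * d * KC \<le> h\<^sup>2"
      using h t KC(1) by (auto simp: d_def min_def field_simps)
    have "m t - d\<^sup>2 / K < m t" using d K by simp
    then obtain x where x: "x \<in> S" "m t - d\<^sup>2 / K < q x - t * c x"
      unfolding m_def[of t] using less_cSUP_iff[OF Sne bdd[of t]] t by auto
    then have xM: "x \<in> M" and x1: "norm x = 1" by (auto simp: S_def)
    have "(norm (P (m t) t x))\<^sup>2 \<le> K * inner (P (m t) t x) x"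
      using positive_op_bound[OF Pop[of "m t" t], of K x] K xM symP Ppos t(1) by simp
    also have "\<dots> \<le> K * (d\<^sup>2 / K)"
      using x(2) K(1) by (intro mult_left_mono) (auto simp: Px xM x1)
    finally have "(norm (P (m t) t x))\<^sup>2 \<le> d\<^sup>2" using K(1) by simp
    then have Pd: "norm (P (m t) t x) \<le> d" using d(1) by (simp add: power2_le_iff_abs_le)
    have "inner (P (m t) t x) x \<le> d"
      using norm_cauchy_schwarz[of "P (m t) t x" x] Pd x1 by simp
    moreover have "0 \<le> inner (P (m (t/2)) (t/2) x) x" using Ppos[of "t/2"] t xM by simp
    \<comment> \<open>Subtracting the two inequalities leaves (t/2) c x \<le> d + m (t/2) - m t,
      which is at most 2 h.\<close>
    ultimately have tc: "t * c x \<le> 4 * h"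
      using s(2) mm rle d(2) by (simp add: Px xM x1)
    \<comment> \<open>Commutation with G1 and G2 turns positivity of P at G1 x and G2 x into
      positivity of the product of P and C at x. This bounds the vector C x, whereas the previous
      estimate bounds only its pairing with x.\<close>
    have "0 \<le> inner (P (m (t/2)) (t/2) (G1 x)) (G1 x) + inner (P (m (t/2)) (t/2) (G2 x)) (G2 x)"
      using Ppos[of "t/2"] t xM G1 G2 by simp
    also have "\<dots> = inner (P (m (t/2)) (t/2) x) (C x)"
      using xM G1 G2 by (simp add: PG1 PG2 sym1 sym2 C_def inner_add_right)
    also have "P (m (t/2)) (t/2) x = P (m t) t x + (m (t/2) - m t) *\<^sub>R x - (t/2) *\<^sub>R C x"
    proof -
      have *: "t *\<^sub>R C x = (t/2) *\<^sub>R C x + (t/2) *\<^sub>R C x" by (simp flip: scaleR_add_left)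
      show ?thesis unfolding P_def * by (simp add: algebra_simps)
    qed
    also have "inner \<dots> (C x) = inner (P (m t) t x) (C x) + (m (t/2) - m t) * c x - (t/2) * (norm (C x))\<^sup>2"
      using cC[OF xM] by (simp add: inner_add_left inner_diff_left inner_commute[of x] power2_norm_eq_inner)
    finally have *: "(t/2) * (norm (C x))\<^sup>2 \<le> inner (P (m t) t x) (C x) + (m (t/2) - m t) * c x"
      by simp
    have "inner (P (m t) t x) (C x) \<le> norm (P (m t) t x) * norm (C x)" by (rule norm_cauchy_schwarz)
    also have "\<dots> \<le> d * KC" using Pd KC(2)[OF xM] x1 d(1) by (intro mult_mono) auto
    finally have "inner (P (m t) t x) (C x) \<le> d * KC" .
    moreover have "(m (t/2) - m t) * c x \<le> h * c x"
      using s(2) mm rle by (intro mult_right_mono c0) auto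
    ultimately have "(t/2) * (norm (C x))\<^sup>2 \<le> d * KC + h * c x" using * by simp
    \<comment> \<open>The factor 2 t turns the left side into (t norm (C x))^2; the right side is
      then at most h^2 + 8 h^2.\<close>
    then have "(2 * t) * ((t/2) * (norm (C x))\<^sup>2) \<le> (2 * t) * (d * KC + h * c x)"
      using t by (intro mult_left_mono) auto
    also have "\<dots> = 2 * t * d * KC + 2 * h * (t * c x)" by (simp add: algebra_simps)
    also have "\<dots> \<le> h\<^sup>2 + 2 * h * (4 * h)"
      using d(3) tc h(1) by (intro add_mono mult_left_mono) auto
    also have "\<dots> = (3 * h)\<^sup>2" by (simp add: power2_eq_square)
    finally have "(t * norm (C x))\<^sup>2 \<le> (3 * h)\<^sup>2" by (simp add: power2_eq_square algebra_simps)
    then have tC: "t * norm (C x) \<le> 3 * h" by (rule power2_le_imp_le) (use h in simp)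
    have "X x - r *\<^sub>R x = (m t - r) *\<^sub>R x + t *\<^sub>R C x - P (m t) t x"
      by (simp add: P_def algebra_simps)
    then have "norm (X x - r *\<^sub>R x) \<le> norm ((m t - r) *\<^sub>R x) + norm (t *\<^sub>R C x) + norm (P (m t) t x)"
      by (simp only: norm_add_diff_le)
    also have "\<dots> \<le> h + 3 * h + h" using x1 rle mm s(2) tC Pd d(2) t by simp
    finally have "norm (X x - r *\<^sub>R x) < e" using h by simp
    moreover have "c x < e\<^sup>2"
      using tc h(3) mult_right_mono[OF t(1) c0[of x]] c0[of x] by simp
    then have "(norm (G1 x))\<^sup>2 < e\<^sup>2" "(norm (G2 x))\<^sup>2 < e\<^sup>2"
      unfolding c_def by (smt (verit) zero_le_power2)+
    then have "norm (G1 x) < e" "norm (G2 x) < e"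
      using e power_less_imp_less_base by (metis less_eq_real_def)+
    ultimately show ?thesis using xM x1 by blast
  qed
  then show ?thesis by blast
qed

end

section \<open>Functional calculus of a normal operator\<close>

text \<open>\<open>calc M A f F\<close> says that \<open>F\<close> is the value at \<open>f\<close> of the functional calculus of \<open>A\<close>.  Uniform limits
  are a rule of the definition, so that properties of the whole calculus follow by rule induction.\<close>

inductive calc ::
    "'a::complex_inner set \<Rightarrow> ('a \<Rightarrow> 'a) \<Rightarrow> (complex \<Rightarrow> complex) \<Rightarrow> ('a \<Rightarrow> 'a) \<Rightarrow> bool"
  for M :: "'a set" and A :: "'a \<Rightarrow> 'a" where
  const: "calc M A (\<lambda>z. c) (\<lambda>x\<in>M. c *\<^sub>C x)"
| ident: "calc M A (\<lambda>z. z) A"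
| conj: "calc M A cnj (op_adjoint M A)"
| add: "calc M A f F \<Longrightarrow> calc M A g G \<Longrightarrow> calc M A (\<lambda>z. f z + g z) (\<lambda>x\<in>M. F x + G x)"
| mult: "calc M A f F \<Longrightarrow> calc M A g G \<Longrightarrow> calc M A (\<lambda>z. f z * g z) (compose M F G)"
| limit: "F \<in> bounded_ops M \<Longrightarrow>
    (\<And>e::real. e > 0 \<Longrightarrow> \<exists>g G. calc M A g G \<and>
      (\<forall>z\<in>op_spectrum M A. cmod (f z - g z) \<le> e) \<and> (\<forall>x\<in>M. norm (F x - G x) \<le> e * norm x)) \<Longrightarrow>
    calc M A f F"

text \<open>A nonzero M has unit vectors, from which \<open>calc_norm_attained\<close> produces a
  spectral value.\<close>

locale normal_operator = closed_csubspace M for M :: "'a::complex_hilbert set" +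
  fixes A :: "'a \<Rightarrow> 'a"
  assumes nonzero: "M \<noteq> {0}" and normal_A: "normal_op A"
begin

abbreviation "\<sigma> \<equiv> op_spectrum M A"
abbreviation "A' \<equiv> op_adjoint M A"

lemma A_op [simp]: "A \<in> bounded_ops M" and A'_op [simp]: "A' \<in> bounded_ops M"
  using normal_A by auto

lemma A_A': "x \<in> M \<Longrightarrow> A (A' x) = A' (A x)"
  using normal_A by (simp add: normal_op_def)

section \<open>Closure properties and commutation in the calculus\<close>

lemma calc_op: "calc M A f F \<Longrightarrow> F \<in> bounded_ops M"
proof (induction rule: calc.induct)
  case (const c)
  show ?case by (rule const_op)
next
  case (add f F g G)
  then show ?case by (intro add_op)
qed (simp_all add: compose_op)

text \<open>The limit rule with the constant approximation f, F has error zero on the spectrum, so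
  only the values there matter.\<close>

lemma calc_cong: "calc M A f F \<Longrightarrow> (\<And>z. z \<in> \<sigma> \<Longrightarrow> f z = g z) \<Longrightarrow> calc M A g F"
  by (rule calc.limit) (auto intro!: calc_op exI[of _ f] exI[of _ F])

lemma calc_diff:
  assumes "calc M A f F" "calc M A g G"
  shows "calc M A (\<lambda>z. f z - g z) (\<lambda>x\<in>M. F x - G x)"
proof -
  have "(\<lambda>x\<in>M. F x + compose M (\<lambda>x\<in>M. (-1) *\<^sub>C x) G x) = (\<lambda>x\<in>M. F x - G x)"
    using calc_op[OF assms(2)] by (intro restrict_ext) (simp add: compose_eq minus_eq_scaleC[symmetric])
  then show ?thesis
    using calc.add[OF assms(1) calc.mult[OF calc.const[of _ _ "-1"] assms(2)]] by simp
qed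

lemma calc_continuous: "calc M A f F \<Longrightarrow> continuous_on \<sigma> f"
proof (induction rule: calc.induct)
  case (limit F f)
  show ?case
    unfolding continuous_on_iff
  proof (intro ballI allI impI)
    fix z and e :: real assume z: "z \<in> \<sigma>" and e: "e > 0"
    obtain g where g: "continuous_on \<sigma> g" "\<And>z. z \<in> \<sigma> \<Longrightarrow> dist (f z) (g z) \<le> e/4"
      using limit.IH[of "e/4"] e by (auto simp: dist_norm)
    obtain d where d: "d > 0" "\<And>w. w \<in> \<sigma> \<Longrightarrow> dist w z < d \<Longrightarrow> dist (g w) (g z) < e/4"
      using g(1) z e unfolding continuous_on_iff by (metis zero_less_divide_iff zero_less_numeral)
    have "dist (f w) (f z) < e" if "w \<in> \<sigma>" "dist w z < d" for w
      using g(2)[OF that(1)] g(2)[OF z] d(2)[OF that] e dist_triangle[of "f w" "f z" "g w"]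
        dist_triangle[of "g w" "f z" "g z"] dist_commute[of "f z" "g z"] by linarith
    then show "\<exists>d>0. \<forall>w\<in>\<sigma>. dist w z < d \<longrightarrow> dist (f w) (f z) < e" using d(1) by blast
  qed
qed (auto intro!: continuous_intros continuous_on_cnj)

lemma calc_adjoint: "calc M A f F \<Longrightarrow> calc M A (\<lambda>z. cnj (f z)) (op_adjoint M F)"
proof (induction rule: calc.induct)
  case (mult f F g G)
  show ?case
    using calc.mult[OF mult.IH(2,1)] mult.hyps
    by (simp add: op_adjoint_compose calc_op mult.commute)
next
  case (limit F f)
  show ?case
  proof (rule calc.limit)
    fix e :: real assume "e > 0"
    then obtain g G where g: "calc M A g G" "calc M A (\<lambda>z. cnj (g z)) (op_adjoint M G)"
      "\<forall>z\<in>\<sigma>. cmod (f z - g z) \<le> e" "\<And>x. x \<in> M \<Longrightarrow> norm (F x - G x) \<le> e * norm x"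
      using limit.IH by blast
    have "norm (op_adjoint M F x - op_adjoint M G x) \<le> e * norm x" if x: "x \<in> M" for x
      using op_adjoint_bound[OF diff_op[OF limit.hyps calc_op[OF g(1)]], of e x] g(4) x
      by (simp add: op_adjoint_diff limit.hyps calc_op[OF g(1)])
    moreover have "\<forall>z\<in>\<sigma>. cmod (cnj (f z) - cnj (g z)) \<le> e"
      using g(3) by (metis complex_cnj_diff complex_mod_cnj)
    ultimately show "\<exists>g G. calc M A g G \<and> (\<forall>z\<in>\<sigma>. cmod (cnj (f z) - g z) \<le> e) \<and>
        (\<forall>x\<in>M. norm (op_adjoint M F x - G x) \<le> e * norm x)"
      using g(2) by blast
  qed (simp add: limit.hyps)
next
  case (const c)
  show ?case using calc.const[of M A "cnj c"] by (simp only: op_adjoint_const)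
next
  case (add f F g G)
  show ?case using calc.add[OF add.IH] add.hyps by (simp only: op_adjoint_add calc_op complex_cnj_add)
qed (simp_all add: op_adjoint_adjoint calc.ident calc.conj)

text \<open>Commuting with A and its adjoint passes through every rule. It is applied to values of
  the calculus and to the projections onto smaller subspaces.\<close>

lemma calc_commute:
  assumes "calc M A f F" and G: "G \<in> bounded_ops M"
    and GA: "\<And>x. x \<in> M \<Longrightarrow> G (A x) = A (G x)" and GA': "\<And>x. x \<in> M \<Longrightarrow> G (A' x) = A' (G x)"
    and "x \<in> M"
  shows "G (F x) = F (G x)"
  using assms(1,5)
proof (induction arbitrary: x rule: calc.induct)
  case (limit F f)
  obtain K where K: "K > 0" "\<And>x. x \<in> M \<Longrightarrow> norm (G x) \<le> K * norm x"
    using op_bound[OF G] by blast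
  have "G (F x) - F (G x) = 0"
  proof (rule small_imp_zero)
    fix e :: real assume "e > 0"
    then obtain h H where h: "calc M A h H" "\<And>x. x \<in> M \<Longrightarrow> G (H x) = H (G x)"
      "\<And>x. x \<in> M \<Longrightarrow> norm (F x - H x) \<le> e * norm x"
      using limit.IH by blast
    have m: "F x \<in> M" "H x \<in> M" "G x \<in> M"
      using limit.hyps calc_op[OF h(1)] G limit.prems by auto
    have "G (F x) - F (G x) = G (F x - H x) - (F (G x) - H (G x))"
      using h(2)[OF limit.prems] m by (simp add: op_diff[OF G])
    then have "norm (G (F x) - F (G x)) \<le> norm (G (F x - H x)) + norm (F (G x) - H (G x))"
      by (metis norm_triangle_ineq4)
    also have "\<dots> \<le> K * (e * norm x) + e * (K * norm x)"
    proof (rule add_mono)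
      show "norm (G (F x - H x)) \<le> K * (e * norm x)"
        by (rule order_trans[OF K(2)]) (use m h(3)[OF limit.prems] K(1) in auto)
      show "norm (F (G x) - H (G x)) \<le> e * (K * norm x)"
        by (rule order_trans[OF h(3)]) (use m K(2)[OF limit.prems] \<open>e > 0\<close> in auto)
    qed
    also have "\<dots> = e * (2 * K * norm x)" by simp
    finally show "norm (G (F x) - F (G x)) \<le> e * (2 * K * norm x)" .
  qed
  then show ?case by simp
qed (use G GA GA' in \<open>simp_all add: op_scaleC op_add compose_eq calc_op\<close>)

text \<open>Two uses of \<open>calc_commute\<close>: first A and its adjoint commute with F, then F
  commutes with G.\<close>

lemma calc_calc_commute:
  assumes f: "calc M A f F" and g: "calc M A g G" and x: "x \<in> M"
  shows "F (G x) = G (F x)"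
proof (rule calc_commute[OF g calc_op[OF f] _ _ x])
  show "F (A x) = A (F x)" if "x \<in> M" for x
    using calc_commute[OF f A_op _ _ that] by (simp add: A_A')
  show "F (A' x) = A' (F x)" if "x \<in> M" for x
    using calc_commute[OF f A'_op _ _ that] by (simp add: A_A')
qed

section \<open>Spectral values and the norm of values of the calculus\<close>

text \<open>Approximate eigenvectors of A for l are approximate eigenvectors of F for f l. The
  separate error e, with K depending on it, is what survives uniform limits: K may grow as the
  approximation improves.\<close>

lemma calc_approx_eigenvector:
  assumes "calc M A f F" and l: "l \<in> \<sigma>" and "e > 0"
  shows "\<exists>K\<ge>0. \<forall>x\<in>M. norm (F x - f l *\<^sub>C x) \<le> e * norm x + K * norm (A x - l *\<^sub>C x)"
  using assms(1,3)
proof (induction arbitrary: e rule: calc.induct)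
  case (const c)
  then show ?case by (intro exI[of _ 0]) auto
next
  case ident
  then show ?case by (intro exI[of _ 1]) auto
next
  case conj
  then show ?case by (intro exI[of _ 1]) (auto simp: norm_adjoint_normal[OF normal_A])
next
  case (add f F g G)
  obtain K where K: "K \<ge> 0" "\<And>x. x \<in> M \<Longrightarrow> norm (F x - f l *\<^sub>C x) \<le> e/2 * norm x + K * norm (A x - l *\<^sub>C x)"
    using add.IH(1)[of "e/2"] add.prems by auto
  obtain L where L: "L \<ge> 0" "\<And>x. x \<in> M \<Longrightarrow> norm (G x - g l *\<^sub>C x) \<le> e/2 * norm x + L * norm (A x - l *\<^sub>C x)"
    using add.IH(2)[of "e/2"] add.prems by auto
  have "norm (F x + G x - (f l + g l) *\<^sub>C x) \<le> e * norm x + (K + L) * norm (A x - l *\<^sub>C x)"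
    if "x \<in> M" for x
  proof -
    have "F x + G x - (f l + g l) *\<^sub>C x = (F x - f l *\<^sub>C x) + (G x - g l *\<^sub>C x)"
      by (simp add: scaleC_add_left)
    then have "norm (F x + G x - (f l + g l) *\<^sub>C x) \<le> norm (F x - f l *\<^sub>C x) + norm (G x - g l *\<^sub>C x)"
      by (metis norm_triangle_ineq)
    then show ?thesis using K(2)[OF that] L(2)[OF that] by (simp add: algebra_simps)
  qed
  then show ?case using K(1) L(1) by (intro exI[of _ "K + L"]) auto
next
  case (mult f F g G)
  obtain B where B: "B > 0" "\<And>x. x \<in> M \<Longrightarrow> norm (F x) \<le> B * norm x"
    using op_bound[OF calc_op[OF mult.hyps(1)]] by blast
  \<comment> \<open>The product is split as F (G - g l) + g l (F - f l), with total relative error d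
    (B + |g l|), which is set equal to e.\<close>
  define d where "d = e / (B + cmod (g l))"
  have s: "B + cmod (g l) > 0" using B by (simp add: add_pos_nonneg)
  then have d: "d > 0" "d * (B + cmod (g l)) = e" using mult.prems by (auto simp: d_def)
  obtain K where K: "K \<ge> 0" "\<And>x. x \<in> M \<Longrightarrow> norm (F x - f l *\<^sub>C x) \<le> d * norm x + K * norm (A x - l *\<^sub>C x)"
    using mult.IH(1)[OF d(1)] by auto
  obtain L where L: "L \<ge> 0" "\<And>x. x \<in> M \<Longrightarrow> norm (G x - g l *\<^sub>C x) \<le> d * norm x + L * norm (A x - l *\<^sub>C x)"
    using mult.IH(2)[OF d(1)] by auto
  have "norm (F (G x) - (f l * g l) *\<^sub>C x) \<le> e * norm x + (B * L + cmod (g l) * K) * norm (A x - l *\<^sub>C x)"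
    if x: "x \<in> M" for x
  proof -
    have F: "F \<in> bounded_ops M" and G: "G \<in> bounded_ops M" using mult.hyps calc_op by auto
    have "F (G x) - (f l * g l) *\<^sub>C x = F (G x - g l *\<^sub>C x) + g l *\<^sub>C (F x - f l *\<^sub>C x)"
      using x F G by (simp add: op_diff op_scaleC complex_vector.scale_right_diff_distrib scaleC_scaleC mult.commute)
    then have "norm (F (G x) - (f l * g l) *\<^sub>C x) \<le>
        norm (F (G x - g l *\<^sub>C x)) + cmod (g l) * norm (F x - f l *\<^sub>C x)"
      by (metis norm_triangle_ineq norm_scaleC)
    also have "\<dots> \<le> B * (d * norm x + L * norm (A x - l *\<^sub>C x)) +
        cmod (g l) * (d * norm x + K * norm (A x - l *\<^sub>C x))"
    proof (intro add_mono mult_left_mono K(2) x)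
      show "norm (F (G x - g l *\<^sub>C x)) \<le> B * (d * norm x + L * norm (A x - l *\<^sub>C x))"
        by (rule order_trans[OF B(2)]) (use L(2)[OF x] B(1) G x in auto)
    qed simp
    also have "\<dots> = (d * (B + cmod (g l))) * norm x + (B * L + cmod (g l) * K) * norm (A x - l *\<^sub>C x)"
      by (simp add: algebra_simps)
    finally show ?thesis unfolding d(2) .
  qed
  then show ?case using K(1) L(1) B(1) by (intro exI[of _ "B * L + cmod (g l) * K"]) (auto simp: compose_eq)
next
  case (limit F f)
  have "e/3 > 0" using limit.prems by simp
  then obtain g G where g: "\<And>d. d > 0 \<Longrightarrow> \<exists>K\<ge>0. \<forall>x\<in>M. norm (G x - g l *\<^sub>C x) \<le> d * norm x + K * norm (A x - l *\<^sub>C x)"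
      "cmod (f l - g l) \<le> e/3" "\<And>x. x \<in> M \<Longrightarrow> norm (F x - G x) \<le> e/3 * norm x"
    using limit.IH[of "e/3"] l by blast
  obtain K where K: "K \<ge> 0" "\<And>x. x \<in> M \<Longrightarrow> norm (G x - g l *\<^sub>C x) \<le> e/3 * norm x + K * norm (A x - l *\<^sub>C x)"
    using g(1)[of "e/3"] limit.prems by auto
  have "norm (F x - f l *\<^sub>C x) \<le> e * norm x + K * norm (A x - l *\<^sub>C x)" if x: "x \<in> M" for x
  proof -
    have "F x - f l *\<^sub>C x = (F x - G x) + (G x - g l *\<^sub>C x) - (f l - g l) *\<^sub>C x"
      by (simp add: complex_vector.scale_left_diff_distrib)
    then have "norm (F x - f l *\<^sub>C x) \<le> norm (F x - G x) + norm (G x - g l *\<^sub>C x) + norm ((f l - g l) *\<^sub>C x)"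
      by (simp only: norm_add_diff_le)
    moreover have "norm ((f l - g l) *\<^sub>C x) \<le> e/3 * norm x"
      unfolding norm_scaleC using g(2) by (rule mult_right_mono) simp
    ultimately show ?thesis using g(3)[OF x] K(2)[OF x] by (simp add: algebra_simps)
  qed
  then show ?case using K(1) by blast
qed

text \<open>Let n be the norm of F. On the joint approximate eigenvectors found here, the adjoint of
  F composed with F acts approximately as n^2 and, by \<open>calc_approx_eigenvector\<close>, as |f
  l|^2; hence n = |f l|.\<close>

lemma calc_norm_attained:
  assumes f: "calc M A f F"
  shows "\<exists>l\<in>\<sigma>. \<forall>x\<in>M. norm (F x) \<le> cmod (f l) * norm x"
proof -
  let ?F' = "op_adjoint M F"
  have F: "F \<in> bounded_ops M" using f by (rule calc_op)
  have F': "?F' \<in> bounded_ops M" using F by simp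
  define S where "S = {x \<in> M. norm x = 1}"
  obtain u where "u \<in> M" "u \<noteq> 0" using nonzero zero_mem by blast
  then have "(1 / norm u) *\<^sub>R u \<in> S" by (simp add: S_def)
  then have Sne: "S \<noteq> {}" by blast
  define n where "n = (SUP x\<in>S. norm (F x))"
  obtain B where B: "B > 0" "\<And>x. x \<in> M \<Longrightarrow> norm (F x) \<le> B * norm x"
    using op_bound[OF F] by blast
  have bdd: "bdd_above ((\<lambda>x. norm (F x)) ` S)"
    using B(2) by (intro bdd_aboveI2[where M = B]) (force simp: S_def)
  have n_ge: "norm (F x) \<le> n" if "x \<in> S" for x
    unfolding n_def by (rule cSUP_upper[OF that bdd])
  have n0: "0 \<le> n" using n_ge Sne norm_ge_zero order_trans by (metis ex_in_conv)
  have Fn: "norm (F x) \<le> n * norm x" if x: "x \<in> M" for x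
  proof (cases "x = 0")
    case True
    then show ?thesis using B(2)[OF x] by simp
  next
    case False
    then have "norm (F ((1 / norm x) *\<^sub>R x)) \<le> n"
      using x by (intro n_ge) (simp add: S_def)
    then show ?thesis using False x by (simp add: op_scaleR[OF F] divide_le_eq)
  qed
  define G where "G = (\<lambda>x\<in>M. n\<^sup>2 *\<^sub>R x - ?F' (F x))"
  have S_calc: "calc M A (\<lambda>z. cnj (f z) * f z) (compose M ?F' F)"
    by (rule calc.mult[OF calc_adjoint[OF f] f])
  have "calc M A (\<lambda>z. of_real (n\<^sup>2) - cnj (f z) * f z) G"
    using calc_diff[OF calc.const S_calc] unfolding G_def
    by (rule back_subst[where P = "calc M A _"]) (auto simp: compose_eq restrict_def scaleR_scaleC)
  then have G_calc: "\<exists>g. calc M A g G" by blast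
  then have G: "G \<in> bounded_ops M" using calc_op by blast
  have G_sym: "inner (G x) y = inner x (G y)" if "x \<in> M" "y \<in> M" for x y
    using that F F' by (simp add: G_def inner_diff_left inner_diff_right
        inner_op_adjoint(2)[OF F]) (simp add: inner_op_adjoint(1)[OF F])
  have Gx: "inner (G x) x = n\<^sup>2 * (norm x)\<^sup>2 - (norm (F x))\<^sup>2" if "x \<in> M" for x
    using that F by (simp add: G_def inner_diff_left inner_op_adjoint(2)[OF F]
        power2_norm_eq_inner)
  have G_pos: "0 \<le> inner (G x) x" if "x \<in> M" for x
    using power_mono[OF Fn[OF that], of 2] by (simp add: Gx that power_mult_distrib)
  \<comment> \<open>The conjunct is doubled because the joint lemma is first applied with both
    penalised operators equal to G.\<close>
  have G_approx: "\<exists>x\<in>M. norm x = 1 \<and> norm (G x) < e \<and> norm (G x) < e" if e: "e > 0" for e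
  proof -
    obtain K where K: "K > 0" "\<And>x. x \<in> M \<Longrightarrow> norm (G x) \<le> K * norm x"
      using op_bound[OF G] by blast
    \<comment> \<open>If norm (F x) exceeds n - d, then n^2 - (norm (F x))^2 is at most 2 n d; the
      added 1 covers n = 0. Multiplied by K this must be below e^2 for
      \<open>positive_op_bound\<close>.\<close>
    define d where "d = e\<^sup>2 / (K * (2 * n + 1))"
    have d: "d > 0" "K * (d * (2 * n + 1)) = e\<^sup>2" using e K n0 by (auto simp: d_def)
    have "n - d < n" using d by simp
    then obtain x where x: "x \<in> S" "n - d < norm (F x)"
      unfolding n_def using less_cSUP_iff[OF Sne bdd] by auto
    then have xM: "x \<in> M" "norm x = 1" by (auto simp: S_def)
    have "n\<^sup>2 - (norm (F x))\<^sup>2 = (n - norm (F x)) * (n + norm (F x))"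
      by (simp add: power2_eq_square algebra_simps)
    also have "\<dots> \<le> d * (2 * n)"
      using x(2) n_ge[OF x(1)] n0 d(1) by (intro mult_mono) auto
    also have "\<dots> < d * (2 * n + 1)" using d(1) by simp
    finally have "inner (G x) x < d * (2 * n + 1)" by (simp add: Gx xM)
    then have "K * inner (G x) x < e\<^sup>2" using K(1) d(2) by (metis mult_strict_left_mono)
    then have "(norm (G x))\<^sup>2 < e\<^sup>2"
      using positive_op_bound[OF G G_sym G_pos K xM(1)] by simp
    then have "norm (G x) < e" using e power_less_imp_less_base by (metis less_eq_real_def)
    then show ?thesis using xM by blast
  qed
  define X where "X = (\<lambda>x\<in>M. (1/2) *\<^sub>C (A x + A' x))"
  define Y where "Y = (\<lambda>x\<in>M. (- \<i>/2) *\<^sub>C (A x - A' x))"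
  have X: "X \<in> bounded_ops M"
    using scale_op[OF add_op[OF A_op A'_op], of "1/2"] unfolding X_def
    by (rule back_subst[where P = "\<lambda>F. F \<in> bounded_ops M"]) (auto simp: restrict_def)
  have Y: "Y \<in> bounded_ops M"
    using scale_op[OF diff_op[OF A_op A'_op], of "- \<i>/2"] unfolding Y_def
    by (rule back_subst[where P = "\<lambda>F. F \<in> bounded_ops M"]) (auto simp: restrict_def)
  have X_sym: "inner (X x) y = inner x (X y)" and Y_sym: "inner (Y x) y = inner x (Y y)"
    if "x \<in> M" "y \<in> M" for x y
    using that by (simp_all add: X_def Y_def inner_eq_Re_cinner cinner_scaleC_left cinner_scaleC_right
        cinner_add_left cinner_add_right cinner_diff_left cinner_diff_right
        cinner_op_adjoint[OF A_op] cinner_op_adjoint'[OF A_op] algebra_simps)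
  have AG: "A (G x) = G (A x)" "A' (G x) = G (A' x)" if "x \<in> M" for x
    using G_calc that calc_calc_commute[OF calc.ident] calc_calc_commute[OF calc.conj] by blast+
  have XG: "X (G x) = G (X x)" and YG: "Y (G x) = G (Y x)" if "x \<in> M" for x
    using that G by (simp_all add: X_def Y_def AG op_scaleC op_add op_diff op_minus)
  have XY: "X (Y x) = Y (X x)" if "x \<in> M" for x
    using that by (simp add: X_def Y_def op_scaleC op_add op_diff A_A' complex_vector.scale_right_diff_distrib
        scaleC_add_right scaleC_scaleC algebra_simps)
  obtain r where r: "\<And>e. e > 0 \<Longrightarrow> \<exists>x\<in>M. norm x = 1 \<and> norm (G x) < e \<and> norm (G x) < e \<and> norm (X x - r *\<^sub>R x) < e"
    using joint_approx_eigenvector[OF X G G X_sym G_sym G_sym XG XG refl G_approx] by blast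
  \<comment> \<open>Shifting by r makes "X is nearly r" a null condition, so it can be imposed
    together with G in the second use of the joint lemma, now for Y.\<close>
  define Xr where "Xr = (\<lambda>x\<in>M. X x - r *\<^sub>R x)"
  have Xr: "Xr \<in> bounded_ops M"
    using diff_op[OF X const_op[of "of_real r"]] unfolding Xr_def
    by (rule back_subst[where P = "\<lambda>F. F \<in> bounded_ops M"]) (auto simp: restrict_def scaleR_scaleC)
  have "\<exists>s::real. \<forall>e>0. \<exists>x\<in>M. norm x = 1 \<and> norm (G x) < e \<and> norm (Xr x) < e \<and> norm (Y x - s *\<^sub>R x) < e"
  proof (rule joint_approx_eigenvector[OF Y G Xr Y_sym G_sym _ YG])
    show "inner (Xr x) y = inner x (Xr y)" if "x \<in> M" "y \<in> M" for x y
      using that by (simp add: Xr_def inner_diff_left inner_diff_right X_sym)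
    show "Y (Xr x) = Xr (Y x)" if "x \<in> M" for x
      using that X Y by (simp add: Xr_def op_diff op_scaleR XY)
    show "G (Xr x) = Xr (G x)" if "x \<in> M" for x
      using that X G by (simp add: Xr_def op_diff op_scaleR XG)
    show "\<exists>x\<in>M. norm x = 1 \<and> norm (G x) < e \<and> norm (Xr x) < e" if "e > 0" for e
      using r[OF that] by (auto simp: Xr_def)
  qed
  then obtain s where s: "\<And>e. e > 0 \<Longrightarrow> \<exists>x\<in>M. norm x = 1 \<and> norm (G x) < e \<and> norm (Xr x) < e \<and> norm (Y x - s *\<^sub>R x) < e"
    by blast
  define l where "l = Complex r s"
  have joint: "\<exists>x\<in>M. norm x = 1 \<and> norm (G x) < e \<and> norm (A x - l *\<^sub>C x) < 2 * e" if e: "e > 0" for e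
  proof -
    obtain x where x: "x \<in> M" "norm x = 1" "norm (G x) < e" "norm (Xr x) < e" "norm (Y x - s *\<^sub>R x) < e"
      using s[OF e] by blast
    have "A x - l *\<^sub>C x = (X x - r *\<^sub>R x) + \<i> *\<^sub>C (Y x - s *\<^sub>R x)"
    proof -
      have "X x + \<i> *\<^sub>C Y x = A x"
        using x(1) by (simp add: X_def Y_def scaleC_scaleC scaleC_add_right complex_vector.scale_right_diff_distrib)
          (simp flip: scaleC_add_left)
      moreover have "l *\<^sub>C x = r *\<^sub>R x + \<i> *\<^sub>C s *\<^sub>R x"
        by (simp add: l_def Complex_eq scaleC_add_left scaleR_scaleC scaleC_scaleC)
      ultimately show ?thesis
        by (simp add: complex_vector.scale_right_diff_distrib algebra_simps)
    qed
    then have "norm (A x - l *\<^sub>C x) \<le> norm (X x - r *\<^sub>R x) + norm (Y x - s *\<^sub>R x)"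
      by (metis norm_triangle_ineq norm_scaleC norm_ii mult_1)
    then show ?thesis using x by (intro bexI[of _ x]) (auto simp: Xr_def)
  qed
  have l: "l \<in> \<sigma>"
  proof (rule spectrum_of_approx_eigenvector[OF A_op])
    show "\<exists>x\<in>M. norm x = 1 \<and> norm (A x - l *\<^sub>C x) < e" if "e > 0" for e
      using joint[of "e/2"] that by auto
  qed
  have fl: "cnj (f l) * f l = of_real ((cmod (f l))\<^sup>2)"
    by (metis complex_norm_square mult.commute)
  have "n\<^sup>2 - (cmod (f l))\<^sup>2 = 0"
  proof (rule small_imp_zero)
    fix e :: real assume e: "e > 0"
    obtain K where K: "K \<ge> 0" "\<And>x. x \<in> M \<Longrightarrow>
        norm (compose M ?F' F x - (cnj (f l) * f l) *\<^sub>C x) \<le> e * norm x + K * norm (A x - l *\<^sub>C x)"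
      using calc_approx_eigenvector[OF S_calc l e] by blast
    \<comment> \<open>The errors of G and of A - l add up to d + K (2 d) = e.\<close>
    define d where "d = e / (2 * K + 1)"
    have d: "d > 0" "d * (2 * K + 1) = e" using e K(1) by (auto simp: d_def)
    obtain x where x: "x \<in> M" "norm x = 1" "norm (G x) < d" "norm (A x - l *\<^sub>C x) < 2 * d"
      using joint[OF d(1)] by blast
    have "of_real (n\<^sup>2 - (cmod (f l))\<^sup>2) *\<^sub>C x = G x + (compose M ?F' F x - (cnj (f l) * f l) *\<^sub>C x)"
      using x(1) unfolding fl by (simp add: G_def compose_eq complex_vector.scale_left_diff_distrib scaleR_scaleC)
    then have "\<bar>n\<^sup>2 - (cmod (f l))\<^sup>2\<bar> = norm (G x + (compose M ?F' F x - (cnj (f l) * f l) *\<^sub>C x))"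
      using x(2) by (metis mult.right_neutral norm_of_real norm_scaleC)
    also have "\<dots> \<le> norm (G x) + norm (compose M ?F' F x - (cnj (f l) * f l) *\<^sub>C x)"
      by (rule norm_triangle_ineq)
    also have "\<dots> \<le> d + (e + K * (2 * d))"
      using K(2)[OF x(1)] x mult_left_mono[of "norm (A x - l *\<^sub>C x)" "2 * d" K] K(1) by simp
    also have "\<dots> = e * 2" using d(2) by (simp add: algebra_simps)
    finally show "norm (n\<^sup>2 - (cmod (f l))\<^sup>2) \<le> e * 2" by simp
  qed
  then have "n = cmod (f l)" using n0 by (simp add: power2_eq_iff_nonneg)
  then show ?thesis using Fn l by blast
qed

text \<open>Evaluating F on unit approximate eigenvectors of A for l. Together with
  \<open>calc_norm_attained\<close> it identifies the operator norm with a maximum over the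
  spectrum.\<close>

lemma calc_norm_ge:
  assumes f: "calc M A f F" and l: "l \<in> \<sigma>"
    and K: "\<And>x. x \<in> M \<Longrightarrow> norm (F x) \<le> K * norm x"
  shows "cmod (f l) \<le> K"
proof (rule field_le_epsilon)
  fix e :: real assume e: "e > 0"
  obtain L where L: "L \<ge> 0" "\<And>x. x \<in> M \<Longrightarrow> norm (F x - f l *\<^sub>C x) \<le> e/2 * norm x + L * norm (A x - l *\<^sub>C x)"
    using calc_approx_eigenvector[OF f l, of "e/2"] e by auto
  define d where "d = e / (2 * L + 1)"
  have d: "d > 0" "L * d \<le> e/2" using e L(1) by (auto simp: d_def field_simps)
  obtain x where x: "x \<in> M" "norm x = 1" "norm (A x - l *\<^sub>C x) < d"
    using approx_eigenvector_of_spectrum[OF normal_A l d(1)] by blast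
  have "cmod (f l) = norm (f l *\<^sub>C x)" using x by (simp add: norm_scaleC)
  also have "\<dots> \<le> norm (F x) + norm (F x - f l *\<^sub>C x)"
    using norm_triangle_ineq4[of "F x" "F x - f l *\<^sub>C x"] by simp
  also have "\<dots> \<le> K + (e/2 + L * d)"
    using K[OF x(1)] L(2)[OF x(1)] x mult_left_mono[of "norm (A x - l *\<^sub>C x)" d L] L(1) by simp
  also have "\<dots> \<le> K + e" using d(2) by simp
  finally show "cmod (f l) \<le> K + e" .
qed

lemma calc_bound:
  assumes "calc M A f F" "\<And>z. z \<in> \<sigma> \<Longrightarrow> cmod (f z) \<le> K" "x \<in> M"
  shows "norm (F x) \<le> K * norm x"
proof -
  obtain l where l: "l \<in> \<sigma>" "norm (F x) \<le> cmod (f l) * norm x"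
    using calc_norm_attained[OF assms(1)] assms(3) by blast
  have "cmod (f l) * norm x \<le> K * norm x" using assms(2)[OF l(1)] by (simp add: mult_right_mono)
  with l(2) show ?thesis by simp
qed

lemma calc_diff_bound:
  assumes f: "calc M A f F" and g: "calc M A g G" and K: "\<And>z. z \<in> \<sigma> \<Longrightarrow> cmod (f z - g z) \<le> K"
    and x: "x \<in> M"
  shows "norm (F x - G x) \<le> K * norm x"
proof -
  have "norm ((\<lambda>x\<in>M. F x - G x) x) \<le> K * norm x"
    by (rule calc_bound[OF calc_diff[OF f g] _ x]) (rule K)
  with x show ?thesis by simp
qed

text \<open>The difference of two values at f belongs to the zero function on the spectrum, so its
  norm bound is 0.\<close>

lemma calc_unique:
  assumes "calc M A f F" "calc M A f G"
  shows "F = G"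
proof (rule op_eqI)
  show "F x = G x" if "x \<in> M" for x
    using calc_diff_bound[OF assms, of 0] that by simp
qed (use assms calc_op in auto)

lemma spectrum_nonempty: "\<sigma> \<noteq> {}"
  using calc_norm_attained[OF calc.ident] by blast

section \<open>Polynomials and extension to continuous functions\<close>

lemma calc_real_polynomial:
  "real_polynomial_function h \<Longrightarrow> \<exists>P. calc M A (\<lambda>z. of_real (h z)) P"
proof (induction rule: real_polynomial_function.induct)
  case (linear h)
  interpret h: bounded_linear h by fact
  \<comment> \<open>Real-linear functionals generate the real polynomials on the plane; each one is
    a combination of z and its conjugate, with these coefficients.\<close>
  define a where "a = (of_real (h 1) - \<i> * of_real (h \<i>)) / 2"
  define b where "b = (of_real (h 1) + \<i> * of_real (h \<i>)) / 2"
  have "complex_of_real (h z) = a * z + b * cnj z" for z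
  proof -
    have "z = Re z *\<^sub>R 1 + Im z *\<^sub>R \<i>" by (simp add: complex_eq_iff)
    then have "h z = h (Re z *\<^sub>R 1 + Im z *\<^sub>R \<i>)" by (rule arg_cong)
    also have "\<dots> = Re z * h 1 + Im z * h \<i>" by (simp only: h.add h.scaleR real_scaleR_def)
    finally show ?thesis by (simp add: a_def b_def complex_eq_iff field_simps)
  qed
  then have eq: "(\<lambda>z. complex_of_real (h z)) = (\<lambda>z. a * z + b * cnj z)" by (rule ext)
  show ?case
    unfolding eq by (rule exI calc.add[OF calc.mult[OF calc.const calc.ident] calc.mult[OF calc.const calc.conj]])+
next
  case (const c)
  show ?case by (rule exI) (rule calc.const)
next
  case (add f g)
  then obtain F G where "calc M A (\<lambda>z. of_real (f z)) F" "calc M A (\<lambda>z. of_real (g z)) G" by blast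
  from calc.add[OF this] show ?case unfolding of_real_add by blast
next
  case (mult f g)
  then obtain F G where "calc M A (\<lambda>z. of_real (f z)) F" "calc M A (\<lambda>z. of_real (g z)) G" by blast
  from calc.mult[OF this] show ?case unfolding of_real_mult by blast
qed

lemma calc_polynomial:
  fixes p :: "complex \<Rightarrow> complex"
  assumes "polynomial_function p"
  shows "\<exists>P. calc M A p P"
proof -
  have "real_polynomial_function (\<lambda>z. Re (p z))" "real_polynomial_function (\<lambda>z. Im (p z))"
    using assms bounded_linear_Re bounded_linear_Im
    unfolding polynomial_function_def by (auto simp: o_def)
  then obtain P Q where "calc M A (\<lambda>z. of_real (Re (p z))) P" "calc M A (\<lambda>z. of_real (Im (p z))) Q"
    using calc_real_polynomial by blast
  then have "calc M A (\<lambda>z. of_real (Re (p z)) + \<i> * of_real (Im (p z)))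
      (\<lambda>x\<in>M. P x + compose M (\<lambda>x\<in>M. \<i> *\<^sub>C x) Q x)"
    by (intro calc.add calc.mult calc.const)
  then show ?thesis unfolding complex_eq[symmetric] by blast
qed

text \<open>Polynomials converging uniformly on the spectrum give operators that are Cauchy in norm
  by \<open>calc_diff_bound\<close>. The limit is formed pointwise; passing to the limit in the
  Cauchy estimate then recovers the uniform error that the limit rule requires.\<close>

lemma calc_total:
  assumes f: "continuous_on \<sigma> f"
  shows "\<exists>F. calc M A f F"
proof -
  define \<epsilon> where "\<epsilon> n = 1 / real (Suc n)" for n
  have \<epsilon>0: "\<epsilon> n > 0" for n by (simp add: \<epsilon>_def)
  have \<epsilon>: "\<epsilon> \<longlonglongrightarrow> 0"
    unfolding \<epsilon>_def using lim_inverse_n'[THEN LIMSEQ_Suc] .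
  have "\<exists>p P. calc M A p P \<and> (\<forall>z\<in>\<sigma>. cmod (f z - p z) \<le> \<epsilon> n)" for n
    using Stone_Weierstrass_polynomial_function[OF normal_op_spectrum_compact[OF normal_A] f \<epsilon>0[of n]]
      calc_polynomial by (meson less_eq_real_def)
  then obtain p P where P: "\<And>n. calc M A (p n) (P n)"
      and p: "\<And>n z. z \<in> \<sigma> \<Longrightarrow> cmod (f z - p n z) \<le> \<epsilon> n"
    by metis
  have PP: "norm (P m x - P n x) \<le> (\<epsilon> m + \<epsilon> n) * norm x" if x: "x \<in> M" for m n x
  proof (rule calc_diff_bound[OF P P _ x])
    fix z assume z: "z \<in> \<sigma>"
    have "cmod (p m z - p n z) \<le> cmod (f z - p n z) + cmod (f z - p m z)"
      using norm_triangle_ineq4[of "f z - p n z" "f z - p m z"] by simp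
    then show "cmod (p m z - p n z) \<le> \<epsilon> m + \<epsilon> n"
      using p[OF z, of m] p[OF z, of n] by simp
  qed
  have "\<exists>y. (\<lambda>n. P n x) \<longlonglongrightarrow> y" if x: "x \<in> M" for x
  proof -
    have "Cauchy (\<lambda>n. P n x)"
      unfolding Cauchy_iff
    proof (intro allI impI)
      fix e :: real assume e: "e > 0"
      have "(\<lambda>n. \<epsilon> n * (2 * norm x)) \<longlonglongrightarrow> 0"
        using \<epsilon> by (rule tendsto_mult_left_zero)
      then have "\<forall>\<^sub>F n in sequentially. \<epsilon> n * (2 * norm x) < e"
        using e by (rule order_tendstoD)
      then obtain N where N: "\<epsilon> N * (2 * norm x) < e"
        unfolding eventually_sequentially by blast
      have "norm (P m x - P n x) < e" if "m \<ge> N" "n \<ge> N" for m n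
      proof -
        have "\<epsilon> m \<le> \<epsilon> N" "\<epsilon> n \<le> \<epsilon> N" using that by (simp_all add: \<epsilon>_def frac_le)
        then have "(\<epsilon> m + \<epsilon> n) * norm x \<le> (\<epsilon> N + \<epsilon> N) * norm x"
          by (intro mult_right_mono) auto
        then show ?thesis using PP[OF x, of m n] N by (simp add: algebra_simps)
      qed
      then show "\<exists>N. \<forall>m\<ge>N. \<forall>n\<ge>N. norm (P m x - P n x) < e" by blast
    qed
    then show ?thesis using Cauchy_convergent convergent_def by blast
  qed
  then obtain F where F: "\<And>x. x \<in> M \<Longrightarrow> (\<lambda>n. P n x) \<longlonglongrightarrow> F x" by metis
  have Pop: "P n \<in> bounded_ops M" for n using P by (rule calc_op)
  have FP: "norm (F x - P n x) \<le> \<epsilon> n * norm x" if x: "x \<in> M" for x n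
  proof (rule LIMSEQ_le)
    show "(\<lambda>m. norm (P m x - P n x)) \<longlonglongrightarrow> norm (F x - P n x)"
      by (intro tendsto_intros F x)
    show "(\<lambda>m. (\<epsilon> m + \<epsilon> n) * norm x) \<longlonglongrightarrow> \<epsilon> n * norm x"
      by (rule tendsto_eq_intros \<epsilon> refl)+ simp
  qed (use PP[OF x] in blast)
  obtain K where K: "K > 0" "\<And>x. x \<in> M \<Longrightarrow> norm (P 0 x) \<le> K * norm x"
    using op_bound[OF Pop] by blast
  have Fop: "restrict F M \<in> bounded_ops M"
  proof (rule restrict_in_bounded_ops)
    show "F x \<in> M" if "x \<in> M" for x
      using closed_sequentially[OF closedM _ F[OF that]] that Pop by simp
    show "F (x + y) = F x + F y" if "x \<in> M" "y \<in> M" for x y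
    proof (rule LIMSEQ_unique)
      show "(\<lambda>n. P n (x + y)) \<longlonglongrightarrow> F (x + y)" using that by (intro F) simp
      show "(\<lambda>n. P n (x + y)) \<longlonglongrightarrow> F x + F y"
        using tendsto_add[OF F[OF that(1)] F[OF that(2)]] that by (simp add: op_add[OF Pop])
    qed
    show "F (c *\<^sub>C x) = c *\<^sub>C F x" if "x \<in> M" for c x
    proof (rule LIMSEQ_unique)
      show "(\<lambda>n. P n (c *\<^sub>C x)) \<longlonglongrightarrow> F (c *\<^sub>C x)" using that by (intro F) simp
      show "(\<lambda>n. P n (c *\<^sub>C x)) \<longlonglongrightarrow> c *\<^sub>C F x"
        using bounded_linear.tendsto[OF bounded_linear_scaleC F[OF that]] that by (simp add: op_scaleC[OF Pop])
    qed
    show "norm (F x) \<le> (K + 1) * norm x" if "x \<in> M" for x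
      using norm_triangle_ineq[of "P 0 x" "F x - P 0 x"] K(2)[OF that] FP[OF that, of 0]
      by (simp add: \<epsilon>_def algebra_simps)
  qed
  have "calc M A f (restrict F M)"
  proof (rule calc.limit[OF Fop])
    fix e :: real assume "e > 0"
    then have "\<forall>\<^sub>F n in sequentially. \<epsilon> n < e" by (rule order_tendstoD(2)[OF \<epsilon>])
    then obtain n where n: "\<epsilon> n \<le> e"
      unfolding eventually_sequentially using less_imp_le by blast
    have "norm (F x - P n x) \<le> e * norm x" if "x \<in> M" for x
      using FP[OF that, of n] mult_right_mono[OF n norm_ge_zero[of x]] by simp
    then show "\<exists>g G. calc M A g G \<and> (\<forall>z\<in>\<sigma>. cmod (f z - g z) \<le> e) \<and>
        (\<forall>x\<in>M. norm (restrict F M x - G x) \<le> e * norm x)"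
      using P[of n] p[of _ n] n by (intro exI[of _ "p n"] exI[of _ "P n"]) force
  qed
  then show ?thesis by blast
qed

section \<open>Existence and uniqueness of the functional calculus\<close>

lemma op_norm_calc:
  assumes f: "calc M A f F"
  shows "op_norm M F = (SUP z\<in>\<sigma>. cmod (f z))"
proof -
  obtain l where l: "l \<in> \<sigma>" "\<And>x. x \<in> M \<Longrightarrow> norm (F x) \<le> cmod (f l) * norm x"
    using calc_norm_attained[OF f] by blast
  have "op_norm M F = cmod (f l)"
    using l by (intro op_norm_eqI) (auto intro: calc_norm_ge[OF f])
  moreover have "(SUP z\<in>\<sigma>. cmod (f z)) = cmod (f l)"
    using l calc_norm_ge[OF f] by (intro cSup_eq_maximum) auto
  ultimately show ?thesis by simp
qed

lemma functional_calculus_calc: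
  "functional_calculus M A (\<lambda>f. THE F. calc M A f F)"
proof -
  let ?\<Phi> = "\<lambda>f. THE F. calc M A f F"
  have eq: "?\<Phi> f = F" if "calc M A f F" for f F
    using that by (intro the_equality) (auto intro: calc_unique)
  have calc: "calc M A f (?\<Phi> f)" if "continuous_on \<sigma> f" for f
    using calc_total[OF that] eq by metis
  have scale: "calc M A (\<lambda>z. c * f z) (\<lambda>x\<in>M. c *\<^sub>C ?\<Phi> f x)" if "continuous_on \<sigma> f" for c f
  proof -
    have "compose M (\<lambda>x\<in>M. c *\<^sub>C x) (?\<Phi> f) = (\<lambda>x\<in>M. c *\<^sub>C ?\<Phi> f x)"
      using calc_op[OF calc[OF that]] by (auto simp: compose_def intro!: restrict_ext)
    then show ?thesis using calc.mult[OF calc.const[of M A c] calc[OF that]] by simp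
  qed
  have "(\<lambda>x\<in>M. 1 *\<^sub>C x) = (\<lambda>x\<in>M. x)" by (simp add: scaleC_one)
  then have one: "calc M A (\<lambda>z. 1) (\<lambda>x\<in>M. x)" using calc.const[of M A 1] by simp
  show ?thesis
    unfolding functional_calculus_def Let_def mem_Collect_eq Ball_def
    by (intro conjI allI impI eq calc_op[OF calc] op_norm_calc[OF calc] calc_adjoint[OF calc]
        calc.add[OF calc calc] calc.mult[OF calc calc] scale one calc.ident)
qed

text \<open>A homomorphism is determined on constants, the identity and conjugation, and its
  isometry carries agreement to uniform limits. This is the uniqueness behind
  \<open>apply_fun\<close>.\<close>

lemma functional_calculus_eq_calc:
  assumes \<Phi>: "functional_calculus M A \<Phi>" and "calc M A f F"
  shows "\<Phi> f = F"
proof -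
  note * = \<Phi>[unfolded functional_calculus_def Let_def mem_Collect_eq Ball_def]
  have op: "\<Phi> f \<in> bounded_ops M" if "continuous_on \<sigma> f" for f using * that by blast
  have add: "\<Phi> (\<lambda>z. f z + g z) = (\<lambda>x\<in>M. \<Phi> f x + \<Phi> g x)"
    and mult: "\<Phi> (\<lambda>z. f z * g z) = compose M (\<Phi> f) (\<Phi> g)"
    if "continuous_on \<sigma> f" "continuous_on \<sigma> g" for f g using * that by blast+
  have scale: "\<Phi> (\<lambda>z. c * f z) = (\<lambda>x\<in>M. c *\<^sub>C \<Phi> f x)" if "continuous_on \<sigma> f" for c f
    using * that by blast
  have cnj: "\<Phi> (\<lambda>z. cnj (f z)) = op_adjoint M (\<Phi> f)" if "continuous_on \<sigma> f" for f
    using * that by blast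
  have norm: "op_norm M (\<Phi> f) = (SUP z\<in>\<sigma>. norm (f z))" if "continuous_on \<sigma> f" for f
    using * that by blast
  have one: "\<Phi> (\<lambda>z. 1) = (\<lambda>x\<in>M. x)" and id: "\<Phi> (\<lambda>z. z) = A" using * by blast+
  \<comment> \<open>Isometry at f - g, written as f + (-1) g because the definition speaks of sums
    and scalar multiples.\<close>
  have dist: "norm (\<Phi> f x - \<Phi> g x) \<le> e * norm x"
    if f: "continuous_on \<sigma> f" and g: "continuous_on \<sigma> g" and e: "\<And>z. z \<in> \<sigma> \<Longrightarrow> cmod (f z - g z) \<le> e"
      and x: "x \<in> M" for f g e x
  proof -
    have mg: "continuous_on \<sigma> (\<lambda>z. (-1) * g z)" and fg: "continuous_on \<sigma> (\<lambda>z. f z + (-1) * g z)"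
      using f g by (auto intro!: continuous_intros)
    have eq: "\<Phi> (\<lambda>z. f z + (-1) * g z) x = \<Phi> f x - \<Phi> g x"
      using x unfolding add[OF f mg] scale[OF g] by (simp add: minus_eq_scaleC[symmetric])
    have "op_norm M (\<Phi> (\<lambda>z. f z + (-1) * g z)) \<le> e"
      unfolding norm[OF fg] using e by (intro cSUP_least spectrum_nonempty) auto
    then have "op_norm M (\<Phi> (\<lambda>z. f z + (-1) * g z)) * norm x \<le> e * norm x"
      by (intro mult_right_mono) auto
    then show ?thesis using op_norm_bound[OF op[OF fg] x] unfolding eq by simp
  qed
  from assms(2) show ?thesis
  proof (induction rule: calc.induct)
    case (const c)
    show ?case
      using scale[of "\<lambda>z. 1" c] by (auto simp: one intro!: restrict_ext)
  next
    case (limit F f)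
    have cf: "continuous_on \<sigma> f"
      using limit.hyps limit.IH by (intro calc_continuous[OF calc.limit]) blast+
    show ?case
    proof (rule op_eqI[OF op[OF cf] limit.hyps])
      fix x assume x: "x \<in> M"
      have "\<Phi> f x - F x = 0"
      proof (rule small_imp_zero)
        fix e :: real assume "e > 0"
        then obtain g G where g: "calc M A g G" "\<Phi> g = G" "\<And>z. z \<in> \<sigma> \<Longrightarrow> cmod (f z - g z) \<le> e"
            "norm (F x - G x) \<le> e * norm x"
          using limit.IH x by blast
        have "norm (\<Phi> f x - F x) \<le> norm (\<Phi> f x - G x) + norm (F x - G x)"
          using norm_triangle_ineq4[of "\<Phi> f x - G x" "F x - G x"] by simp
        also have "\<dots> \<le> e * norm x + e * norm x"
          using dist[OF cf calc_continuous[OF g(1)] g(3) x] g(2,4) by simp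
        finally show "norm (\<Phi> f x - F x) \<le> e * (2 * norm x)" by simp
      qed
      then show "\<Phi> f x = F x" by simp
    qed
  next
    case conj
    show ?case using cnj[of "\<lambda>z. z"] id by simp
  qed (simp_all add: id add mult calc_continuous)
qed

lemma apply_fun_eq_calc: "calc M A f F \<Longrightarrow> apply_fun M f A = F"
  unfolding apply_fun_def
  using functional_calculus_calc functional_calculus_eq_calc by (intro the_equality) blast+

lemma calc_apply_fun: "continuous_on \<sigma> f \<Longrightarrow> calc M A f (apply_fun M f A)"
  using calc_total apply_fun_eq_calc by metis

section \<open>Spectral mapping for one bounded normal operator\<close>

lemma calc_spectrum:
  assumes f: "calc M A f F"
  shows "op_spectrum M F = f ` \<sigma>"
proof (intro set_eqI iffI)
  fix m assume "m \<in> f ` \<sigma>"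
  then obtain l where l: "l \<in> \<sigma>" "m = f l" by blast
  show "m \<in> op_spectrum M F"
    unfolding l(2)
  proof (rule spectrum_of_approx_eigenvector[OF calc_op[OF f]])
    fix e :: real assume e: "e > 0"
    obtain K where K: "K \<ge> 0" "\<And>x. x \<in> M \<Longrightarrow> norm (F x - f l *\<^sub>C x) \<le> e/2 * norm x + K * norm (A x - l *\<^sub>C x)"
      using calc_approx_eigenvector[OF f l(1), of "e/2"] e by auto
    define d where "d = e / (2 * K + 1)"
    have d: "d > 0" "d * (2 * K + 1) = e" using e K(1) by (auto simp: d_def)
    obtain x where x: "x \<in> M" "norm x = 1" "norm (A x - l *\<^sub>C x) < d"
      using approx_eigenvector_of_spectrum[OF normal_A l(1) d(1)] by blast
    have "norm (F x - f l *\<^sub>C x) \<le> e/2 + K * d"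
      using K(2)[OF x(1)] x mult_left_mono[of "norm (A x - l *\<^sub>C x)" d K] K(1) by simp
    also have "\<dots> < e" using d by (simp add: algebra_simps)
    finally show "\<exists>x\<in>M. norm x = 1 \<and> norm (F x - f l *\<^sub>C x) < e" using x by blast
  qed
next
  fix m assume m: "m \<in> op_spectrum M F"
  show "m \<in> f ` \<sigma>"
  proof (rule ccontr)
    assume neg: "m \<notin> f ` \<sigma>"
    have h: "calc M A (\<lambda>z. m - f z) (\<lambda>x\<in>M. (\<lambda>x\<in>M. m *\<^sub>C x) x - F x)"
      by (rule calc_diff[OF calc.const f])
    have "continuous_on \<sigma> (\<lambda>z. inverse (m - f z))"
      using neg by (intro continuous_on_inverse calc_continuous[OF h]) auto
    then obtain B where B: "calc M A (\<lambda>z. inverse (m - f z)) B"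
      using calc_total by blast
    have ne: "m - f z \<noteq> 0" if "z \<in> \<sigma>" for z using neg that by auto
    \<comment> \<open>The product with the inverse equals 1 on the spectrum, and it is 0 wherever m
      - f z = 0; \<open>calc_cong\<close> needs agreement on the spectrum alone.\<close>
    have one: "calc M A (\<lambda>z. 1) (compose M (\<lambda>x\<in>M. (\<lambda>x\<in>M. m *\<^sub>C x) x - F x) B)"
      by (rule calc_cong[OF calc.mult[OF h B]]) (rule right_inverse[OF ne])
    have two: "calc M A (\<lambda>z. 1) (compose M B (\<lambda>x\<in>M. (\<lambda>x\<in>M. m *\<^sub>C x) x - F x))"
      by (rule calc_cong[OF calc.mult[OF B h]]) (rule left_inverse[OF ne])
    have 1: "m *\<^sub>C B x - F (B x) = x" "B (m *\<^sub>C x - F x) = x" if x: "x \<in> M" for x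
      using fun_cong[OF calc_unique[OF one calc.const], of x]
        fun_cong[OF calc_unique[OF two calc.const], of x] x calc_op[OF B]
      by (simp_all add: compose_eq scaleC_one)
    show False
      using not_in_op_spectrumI[OF calc_op[OF f] calc_op[OF B], of m] 1 m by blast
  qed
qed

end

section \<open>The local algebra\<close>

context subspace_family
begin

abbreviation "D \<equiv> local_domain H"

lemma closed_csubspace_H: "closed_csubspace (H \<alpha>)"
  by (rule closed_csubspace.intro[OF subspace_H closed_H])

sublocale sub: closed_csubspace "H \<alpha>" for \<alpha>
  by (rule closed_csubspace_H)

lemma H_mono: "\<alpha> \<le> \<beta> \<Longrightarrow> x \<in> H \<alpha> \<Longrightarrow> x \<in> H \<beta>"
  using increasing_H by blast

lemma H_domain: "x \<in> H \<alpha> \<Longrightarrow> x \<in> D"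
  by (auto simp: local_domain_def)

lemma domain_obtain_above:
  assumes "x \<in> D"
  obtains \<beta> where "\<alpha> \<le> \<beta>" "x \<in> H \<beta>"
proof -
  obtain \<gamma> where "x \<in> H \<gamma>" using assms by (auto simp: local_domain_def)
  then show thesis using that directed[of \<alpha> \<gamma>] H_mono by blast
qed

lemma domain_obtain2:
  assumes "x \<in> D" "y \<in> D"
  obtains \<gamma> where "x \<in> H \<gamma>" "y \<in> H \<gamma>"
proof -
  obtain \<alpha> where "x \<in> H \<alpha>" using assms by (auto simp: local_domain_def)
  moreover obtain \<gamma> where "\<alpha> \<le> \<gamma>" "y \<in> H \<gamma>" using domain_obtain_above[OF assms(2)] by blast
  ultimately show thesis using that H_mono by blast
qed

lemma local_algebra_restrict_op: "T \<in> local_algebra H \<Longrightarrow> restrict T (H \<alpha>) \<in> bounded_ops (H \<alpha>)"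
  and local_algebra_orth_proj:
    "T \<in> local_algebra H \<Longrightarrow> x \<in> D \<Longrightarrow> orth_proj (H \<alpha>) (T x) = T (orth_proj (H \<alpha>) x)"
  by (auto simp: local_algebra_def)

lemma local_algebra_maps: "T \<in> local_algebra H \<Longrightarrow> x \<in> H \<alpha> \<Longrightarrow> T x \<in> H \<alpha>"
  using sub.op_mem[OF local_algebra_restrict_op] by fastforce

lemma local_algebra_eqI:
  assumes "S \<in> local_algebra H" "T \<in> local_algebra H" "\<And>\<alpha>. restrict S (H \<alpha>) = restrict T (H \<alpha>)"
  shows "S = T"
proof (rule PiE_ext)
  show "S \<in> D \<rightarrow>\<^sub>E D" "T \<in> D \<rightarrow>\<^sub>E D" using assms(1,2) by (auto simp: local_algebra_def)
  show "S x = T x" if "x \<in> D" for x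
    using that assms(3) by (metis domain_obtain2 restrict_apply')
qed

text \<open>Directedness makes comparable indices suffice in the hypotheses. The same gluing yields
  the adjoint, l - T, the inverse of l - T and f(T); unique existence is the form that the definite
  descriptions call for.\<close>

lemma local_algebra_glue:
  assumes op: "\<And>\<alpha>. F \<alpha> \<in> bounded_ops (H \<alpha>)"
    and coh: "\<And>\<alpha> \<beta> x. \<alpha> \<le> \<beta> \<Longrightarrow> x \<in> H \<alpha> \<Longrightarrow> F \<beta> x = F \<alpha> x"
    and comm: "\<And>\<alpha> \<beta> x. \<alpha> \<le> \<beta> \<Longrightarrow> x \<in> H \<beta> \<Longrightarrow> orth_proj (H \<alpha>) (F \<beta> x) = F \<beta> (orth_proj (H \<alpha>) x)"
  shows "\<exists>!S. S \<in> local_algebra H \<and> (\<forall>\<alpha>. restrict S (H \<alpha>) = F \<alpha>)"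
proof -
  \<comment> \<open>The chosen index is arbitrary: an upper bound of it and any other admissible
    index gives the same value by coherence.\<close>
  define S where "S = (\<lambda>x\<in>D. F (SOME \<alpha>. x \<in> H \<alpha>) x)"
  have S: "S x = F \<alpha> x" if x: "x \<in> H \<alpha>" for x \<alpha>
  proof -
    let ?\<beta> = "SOME \<alpha>. x \<in> H \<alpha>"
    obtain \<gamma> where "\<alpha> \<le> \<gamma>" "?\<beta> \<le> \<gamma>" using directed by blast
    then show ?thesis
      using coh[of \<alpha> \<gamma> x] coh[of ?\<beta> \<gamma> x] x someI[of "\<lambda>\<alpha>. x \<in> H \<alpha>"] H_domain
      by (simp add: S_def)
  qed
  have r: "restrict S (H \<alpha>) = F \<alpha>" for \<alpha>
    using sub.restrict_op[OF op] S by (metis restrict_ext)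
  have "S \<in> local_algebra H"
    unfolding local_algebra_def mem_Collect_eq clinear_on_def
  proof (intro conjI allI ballI)
    have "S x \<in> D" if "x \<in> D" for x
      using that S op sub.op_mem H_domain by (metis domain_obtain2)
    then show "S \<in> D \<rightarrow>\<^sub>E D" by (auto simp: S_def)
    show "S (x + y) = S x + S y" if xy: "x \<in> D" "y \<in> D" for x y
    proof -
      obtain \<gamma> where "x \<in> H \<gamma>" "y \<in> H \<gamma>" using domain_obtain2[OF xy] by blast
      then show ?thesis using S[of _ \<gamma>] sub.op_add[OF op] by simp
    qed
    show "S (c *\<^sub>C x) = c *\<^sub>C S x" if x: "x \<in> D" for c x
    proof -
      obtain \<gamma> where "x \<in> H \<gamma>" using domain_obtain2[OF x x] by blast
      then show ?thesis using S[of _ \<gamma>] sub.op_scaleC[OF op] by simp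
    qed
    show "orth_proj (H \<alpha>) (S x) = S (orth_proj (H \<alpha>) x)" if x: "x \<in> D" for \<alpha> x
    proof -
      obtain \<gamma> where g: "\<alpha> \<le> \<gamma>" "x \<in> H \<gamma>" using domain_obtain_above[OF x] by blast
      then show ?thesis
        using comm[OF g] S[OF g(2)] S[of "orth_proj (H \<alpha>) x" \<gamma>] H_mono[OF g(1)] by simp
    qed
    show "restrict S (H \<alpha>) \<in> bounded_ops (H \<alpha>)" for \<alpha> using r op by simp
  qed
  then show ?thesis using r local_algebra_eqI by (intro ex1I[of _ S]) auto
qed

context
  fixes T :: "'a \<Rightarrow> 'a"
  assumes T: "T \<in> local_algebra H"
begin

abbreviation "T\<^sub>r \<alpha> \<equiv> restrict T (H \<alpha>)"

lemma T_op [simp]: "T\<^sub>r \<alpha> \<in> bounded_ops (H \<alpha>)"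
  by (rule local_algebra_restrict_op[OF T])

lemma T_maps [simp]: "x \<in> H \<alpha> \<Longrightarrow> T x \<in> H \<alpha>"
  by (rule local_algebra_maps[OF T])

lemma T_orth_proj: "x \<in> H \<beta> \<Longrightarrow> T (orth_proj (H \<alpha>) x) = orth_proj (H \<alpha>) (T x)"
  using local_algebra_orth_proj[OF T] H_domain by metis

section \<open>Adjoints and normality of the restrictions\<close>

lemma cinner_adjoint_T:
  "x \<in> H \<alpha> \<Longrightarrow> y \<in> H \<alpha> \<Longrightarrow> cinner x (op_adjoint (H \<alpha>) (T\<^sub>r \<alpha>) y) = cinner (T x) y"
  using sub.cinner_op_adjoint[OF T_op, of x \<alpha> y] by simp

text \<open>A vector of \<open>H \<alpha>\<close> pairs with z only through the projection of z, and
  T commutes with this projection. So the adjoint on the smaller space already has the property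
  defining the adjoint on the larger one.\<close>

lemma adjoint_restrict:
  assumes le: "\<alpha> \<le> \<beta>" and x: "x \<in> H \<alpha>"
  shows "op_adjoint (H \<beta>) (T\<^sub>r \<beta>) x = op_adjoint (H \<alpha>) (T\<^sub>r \<alpha>) x"
proof (rule sub.eq_if_cinner_eq)
  have x': "x \<in> H \<beta>" using H_mono[OF le x] .
  show "op_adjoint (H \<beta>) (T\<^sub>r \<beta>) x \<in> H \<beta>" using x' by simp
  have m: "op_adjoint (H \<alpha>) (T\<^sub>r \<alpha>) x \<in> H \<alpha>" using x by simp
  then show "op_adjoint (H \<alpha>) (T\<^sub>r \<alpha>) x \<in> H \<beta>" by (rule H_mono[OF le])
  fix z assume z: "z \<in> H \<beta>"
  have "cinner z (op_adjoint (H \<alpha>) (T\<^sub>r \<alpha>) x) = cinner (T (orth_proj (H \<alpha>) z)) x"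
    using sub.cinner_orth_proj[of \<alpha> z "op_adjoint (H \<alpha>) (T\<^sub>r \<alpha>) x"] m
      cinner_adjoint_T[OF sub.orth_proj_mem x, of z] by simp
  also have "\<dots> = cinner (T z) x"
    using z x sub.cinner_orth_proj by (simp add: T_orth_proj)
  finally show "cinner z (op_adjoint (H \<beta>) (T\<^sub>r \<beta>) x) = cinner z (op_adjoint (H \<alpha>) (T\<^sub>r \<alpha>) x)"
    using z x' by (simp add: cinner_adjoint_T)
qed

lemma adjoint_orth_proj:
  assumes le: "\<alpha> \<le> \<beta>" and x: "x \<in> H \<beta>"
  shows "orth_proj (H \<alpha>) (op_adjoint (H \<beta>) (T\<^sub>r \<beta>) x) = op_adjoint (H \<beta>) (T\<^sub>r \<beta>) (orth_proj (H \<alpha>) x)"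
proof (rule sub.eq_if_cinner_eq)
  have m: "orth_proj (H \<alpha>) y \<in> H \<beta>" for y using H_mono[OF le] by simp
  show "orth_proj (H \<alpha>) (op_adjoint (H \<beta>) (T\<^sub>r \<beta>) x) \<in> H \<beta>" by (rule m)
  show "op_adjoint (H \<beta>) (T\<^sub>r \<beta>) (orth_proj (H \<alpha>) x) \<in> H \<beta>" using m by simp
  fix z assume z: "z \<in> H \<beta>"
  have "cinner z (orth_proj (H \<alpha>) (op_adjoint (H \<beta>) (T\<^sub>r \<beta>) x)) = cinner (T (orth_proj (H \<alpha>) z)) x"
    using cinner_adjoint_T[OF m x] by (simp add: sub.cinner_orth_proj[symmetric])
  also have "\<dots> = cinner z (op_adjoint (H \<beta>) (T\<^sub>r \<beta>) (orth_proj (H \<alpha>) x))"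
    using cinner_adjoint_T[OF z m] z by (simp add: T_orth_proj sub.cinner_orth_proj)
  finally show "cinner z (orth_proj (H \<alpha>) (op_adjoint (H \<beta>) (T\<^sub>r \<beta>) x)) =
      cinner z (op_adjoint (H \<beta>) (T\<^sub>r \<beta>) (orth_proj (H \<alpha>) x))" .
qed

lemma restrict_local_adjoint:
  "restrict (local_adjoint H T) (H \<alpha>) = op_adjoint (H \<alpha>) (T\<^sub>r \<alpha>)"
proof -
  have "\<exists>!S. S \<in> local_algebra H \<and> (\<forall>\<alpha>. restrict S (H \<alpha>) = op_adjoint (H \<alpha>) (T\<^sub>r \<alpha>))"
    by (rule local_algebra_glue) (simp_all add: adjoint_restrict adjoint_orth_proj)
  from theI'[OF this] show ?thesis unfolding local_adjoint_def by blast
qed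

lemma normal_operator_restrict:
  assumes "local_normal H T"
  shows "normal_operator (H \<alpha>) (T\<^sub>r \<alpha>)"
proof (unfold_locales)
  have adj: "op_adjoint (H \<alpha>) (T\<^sub>r \<alpha>) x = local_adjoint H T x" if "x \<in> H \<alpha>" for x
    using that by (simp flip: restrict_local_adjoint)
  have "T (local_adjoint H T x) = local_adjoint H T (T x)" if "x \<in> H \<alpha>" for x
    using fun_cong[OF assms[unfolded local_normal_def], of x] H_domain[OF that] by (simp add: compose_eq)
  moreover have "local_adjoint H T x \<in> H \<alpha>" if "x \<in> H \<alpha>" for x
    using sub.op_mem[OF sub.op_adjoint_op[OF T_op] that] adj[OF that] by simp
  ultimately show "closed_csubspace.normal_op (H \<alpha>) (T\<^sub>r \<alpha>)"
    unfolding sub.normal_op_def using adj by simp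
qed (rule nonzero_H)

section \<open>Spectra of the restrictions and the local spectrum\<close>

text \<open>Commutation with a smaller projection P is inherited from l - T: P B = B (l - T) P B = B
  P (l - T) B = B P. Both restriction and gluing of inverses rest on it.\<close>

lemma resolvent:
  assumes "l \<notin> op_spectrum (H \<beta>) (T\<^sub>r \<beta>)"
  obtains B where "B \<in> bounded_ops (H \<beta>)" "\<And>x. x \<in> H \<beta> \<Longrightarrow> B (l *\<^sub>C x - T x) = x"
    "\<And>x. x \<in> H \<beta> \<Longrightarrow> l *\<^sub>C B x - T (B x) = x"
    "\<And>\<alpha> x. \<alpha> \<le> \<beta> \<Longrightarrow> x \<in> H \<beta> \<Longrightarrow> orth_proj (H \<alpha>) (B x) = B (orth_proj (H \<alpha>) x)"
proof -
  obtain B where B: "B \<in> bounded_ops (H \<beta>)" and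
      B': "\<And>x. x \<in> H \<beta> \<Longrightarrow> B (l *\<^sub>C x - T\<^sub>r \<beta> x) = x" "\<And>x. x \<in> H \<beta> \<Longrightarrow> l *\<^sub>C B x - T\<^sub>r \<beta> (B x) = x"
    using sub.op_invertibleI[OF T_op assms] by blast
  have 1: "B (l *\<^sub>C x - T x) = x" and 2: "l *\<^sub>C B x - T (B x) = x" if "x \<in> H \<beta>" for x
    using B'[OF that] sub.op_mem[OF B that] that by simp_all
  show thesis
  proof (rule that[OF B 1 2])
    fix \<alpha> x assume le: "\<alpha> \<le> \<beta>" and x: "x \<in> H \<beta>"
    let ?P = "orth_proj (H \<alpha>)"
    have Bx: "B x \<in> H \<beta>" using B x by simp
    have "?P (B x) = B (l *\<^sub>C ?P (B x) - T (?P (B x)))"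
      using 1[of "?P (B x)"] H_mono[OF le] by simp
    also have "\<dots> = B (?P (l *\<^sub>C B x - T (B x)))"
      by (simp add: T_orth_proj[OF Bx] sub.orth_proj_diff sub.orth_proj_scaleC)
    finally show "?P (B x) = B (?P x)" using 2[OF x] by simp
  qed
qed

text \<open>An inverse on \<open>H \<beta>\<close> commutes with the projection onto
  \<open>H \<alpha>\<close>, so it maps \<open>H \<alpha>\<close> into itself and restricts to an
  inverse there.\<close>

lemma op_spectrum_mono:
  assumes le: "\<alpha> \<le> \<beta>"
  shows "op_spectrum (H \<alpha>) (T\<^sub>r \<alpha>) \<subseteq> op_spectrum (H \<beta>) (T\<^sub>r \<beta>)"
proof (rule subsetI, rule ccontr)
  fix l assume l: "l \<in> op_spectrum (H \<alpha>) (T\<^sub>r \<alpha>)" and "l \<notin> op_spectrum (H \<beta>) (T\<^sub>r \<beta>)"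
  from resolvent[OF this(2)]
  obtain B where B: "B \<in> bounded_ops (H \<beta>)" "\<And>x. x \<in> H \<beta> \<Longrightarrow> B (l *\<^sub>C x - T x) = x"
    "\<And>x. x \<in> H \<beta> \<Longrightarrow> l *\<^sub>C B x - T (B x) = x"
    "\<And>\<alpha> x. \<alpha> \<le> \<beta> \<Longrightarrow> x \<in> H \<beta> \<Longrightarrow> orth_proj (H \<alpha>) (B x) = B (orth_proj (H \<alpha>) x)"
    by blast
  have maps: "B x \<in> H \<alpha>" if "x \<in> H \<alpha>" for x
    using B(4)[OF le H_mono[OF le that]] that sub.orth_proj_mem by (metis sub.orth_proj_self)
  have "restrict B (H \<alpha>) \<in> bounded_ops (H \<alpha>)"
    using sub.op_restrict_subspace[OF B(1) closed_csubspace_H increasing_H[OF le]] maps by blast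
  then have "l \<notin> op_spectrum (H \<alpha>) (T\<^sub>r \<alpha>)"
    by (rule sub.not_in_op_spectrumI[OF T_op]) (use maps B(2,3) H_mono[OF le] in auto)
  with l show False by blast
qed

lemma resolvent_op: "(\<lambda>x\<in>H \<alpha>. l *\<^sub>C x - T x) \<in> bounded_ops (H \<alpha>)"
proof -
  have "(\<lambda>x\<in>H \<alpha>. l *\<^sub>C x - T x) = (\<lambda>x\<in>H \<alpha>. (\<lambda>x\<in>H \<alpha>. l *\<^sub>C x) x - T\<^sub>r \<alpha> x)"
    by (rule restrict_ext) simp
  then show ?thesis using sub.diff_op[OF sub.const_op T_op] by simp
qed

text \<open>Membership in the algebra is a clause of \<open>invertible_in\<close>, so l - T has to
  be placed in the algebra before its invertibility can be asserted.\<close>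

lemma resolvent_local: "(\<lambda>x\<in>D. l *\<^sub>C x - T x) \<in> local_algebra H"
proof -
  have "\<exists>!S. S \<in> local_algebra H \<and> (\<forall>\<alpha>. restrict S (H \<alpha>) = (\<lambda>x\<in>H \<alpha>. l *\<^sub>C x - T x))"
  proof (rule local_algebra_glue[OF resolvent_op])
    show "orth_proj (H \<alpha>) ((\<lambda>x\<in>H \<beta>. l *\<^sub>C x - T x) x) = (\<lambda>x\<in>H \<beta>. l *\<^sub>C x - T x) (orth_proj (H \<alpha>) x)"
      if "\<alpha> \<le> \<beta>" "x \<in> H \<beta>" for \<alpha> \<beta> x
      using that H_mono[OF that(1)]
      by (simp add: T_orth_proj[OF that(2)] sub.orth_proj_diff sub.orth_proj_scaleC)
  qed (simp add: H_mono)
  then obtain S where S: "S \<in> local_algebra H" "\<And>\<alpha>. restrict S (H \<alpha>) = (\<lambda>x\<in>H \<alpha>. l *\<^sub>C x - T x)"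
    by blast
  have "S = (\<lambda>x\<in>D. l *\<^sub>C x - T x)"
  proof (rule extensionalityI)
    show "S \<in> extensional D" using S(1) by (auto simp: local_algebra_def PiE_def)
    fix x assume x: "x \<in> D"
    then obtain \<alpha> where "x \<in> H \<alpha>" by (metis domain_obtain2)
    then show "S x = (\<lambda>x\<in>D. l *\<^sub>C x - T x) x"
      using fun_cong[OF S(2), of \<alpha> x] x by simp
  qed simp
  with S(1) show ?thesis by simp
qed

text \<open>An inverse in the local algebra restricts to every level. Conversely the inverses on the
  levels are coherent and commute with the projections, so they glue, whatever their norms.\<close>

lemma local_spectrum_eq: "local_spectrum H T = (\<Union>\<alpha>. op_spectrum (H \<alpha>) (T\<^sub>r \<alpha>))"
proof (intro set_eqI iffI)
  fix l assume "l \<in> (\<Union>\<alpha>. op_spectrum (H \<alpha>) (T\<^sub>r \<alpha>))"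
  then obtain \<alpha> where l: "l \<in> op_spectrum (H \<alpha>) (T\<^sub>r \<alpha>)" by blast
  show "l \<in> local_spectrum H T"
  proof (rule ccontr)
    assume "l \<notin> local_spectrum H T"
    then obtain S where S: "S \<in> local_algebra H"
        and 1: "compose D (\<lambda>x\<in>D. l *\<^sub>C x - T x) S = (\<lambda>x\<in>D. x)"
        and 2: "compose D S (\<lambda>x\<in>D. l *\<^sub>C x - T x) = (\<lambda>x\<in>D. x)"
      by (auto simp: local_spectrum_def spectrum_in_def invertible_in_def)
    have "l \<notin> op_spectrum (H \<alpha>) (T\<^sub>r \<alpha>)"
    proof (rule sub.not_in_op_spectrumI[OF T_op local_algebra_restrict_op[OF S]])
      fix x assume x: "x \<in> H \<alpha>"
      have Sx: "S x \<in> H \<alpha>" by (rule local_algebra_maps[OF S x])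
      show "restrict S (H \<alpha>) (l *\<^sub>C x - T\<^sub>r \<alpha> x) = x"
        using fun_cong[OF 2, of x] x H_domain[OF x] by (simp add: compose_eq)
      show "l *\<^sub>C restrict S (H \<alpha>) x - T\<^sub>r \<alpha> (restrict S (H \<alpha>) x) = x"
        using fun_cong[OF 1, of x] x H_domain[OF x] Sx H_domain[OF Sx] by (simp add: compose_eq)
    qed
    with l show False by blast
  qed
next
  fix l assume l: "l \<in> local_spectrum H T"
  show "l \<in> (\<Union>\<alpha>. op_spectrum (H \<alpha>) (T\<^sub>r \<alpha>))"
  proof (rule ccontr)
    assume neg: "l \<notin> (\<Union>\<alpha>. op_spectrum (H \<alpha>) (T\<^sub>r \<alpha>))"
    have "\<forall>\<beta>. \<exists>B. B \<in> bounded_ops (H \<beta>) \<and> (\<forall>x\<in>H \<beta>. B (l *\<^sub>C x - T x) = x) \<and>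
        (\<forall>x\<in>H \<beta>. l *\<^sub>C B x - T (B x) = x) \<and>
        (\<forall>\<alpha>\<le>\<beta>. \<forall>x\<in>H \<beta>. orth_proj (H \<alpha>) (B x) = B (orth_proj (H \<alpha>) x))"
    proof
      fix \<beta>
      have "l \<notin> op_spectrum (H \<beta>) (T\<^sub>r \<beta>)" using neg by blast
      from resolvent[OF this]
      obtain B where "B \<in> bounded_ops (H \<beta>)" "\<And>x. x \<in> H \<beta> \<Longrightarrow> B (l *\<^sub>C x - T x) = x"
        "\<And>x. x \<in> H \<beta> \<Longrightarrow> l *\<^sub>C B x - T (B x) = x"
        "\<And>\<alpha> x. \<alpha> \<le> \<beta> \<Longrightarrow> x \<in> H \<beta> \<Longrightarrow> orth_proj (H \<alpha>) (B x) = B (orth_proj (H \<alpha>) x)"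
        by blast
      then show "\<exists>B. B \<in> bounded_ops (H \<beta>) \<and> (\<forall>x\<in>H \<beta>. B (l *\<^sub>C x - T x) = x) \<and>
          (\<forall>x\<in>H \<beta>. l *\<^sub>C B x - T (B x) = x) \<and>
          (\<forall>\<alpha>\<le>\<beta>. \<forall>x\<in>H \<beta>. orth_proj (H \<alpha>) (B x) = B (orth_proj (H \<alpha>) x))"
        by blast
    qed
    then obtain B where B: "\<And>\<beta>. B \<beta> \<in> bounded_ops (H \<beta>)"
        "\<And>\<beta> x. x \<in> H \<beta> \<Longrightarrow> B \<beta> (l *\<^sub>C x - T x) = x"
        "\<And>\<beta> x. x \<in> H \<beta> \<Longrightarrow> l *\<^sub>C B \<beta> x - T (B \<beta> x) = x"
        "\<And>\<alpha> \<beta> x. \<alpha> \<le> \<beta> \<Longrightarrow> x \<in> H \<beta> \<Longrightarrow> orth_proj (H \<alpha>) (B \<beta> x) = B \<beta> (orth_proj (H \<alpha>) x)"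
      by metis
    have "\<exists>!S. S \<in> local_algebra H \<and> (\<forall>\<alpha>. restrict S (H \<alpha>) = B \<alpha>)"
    proof (rule local_algebra_glue[OF B(1) _ B(4)])
      fix \<alpha> \<beta> x assume le: "\<alpha> \<le> \<beta>" and x: "x \<in> H \<alpha>"
      have "B \<alpha> x \<in> H \<beta>" using H_mono[OF le] B(1) x by simp
      \<comment> \<open>Since x = (l - T) (B \<alpha> x), applying B \<beta> returns B \<alpha>
        x.\<close>
      then show "B \<beta> x = B \<alpha> x" using B(2)[of "B \<alpha> x" \<beta>] B(3)[OF x] by simp
    qed
    then obtain S where S: "S \<in> local_algebra H" "\<And>\<alpha>. restrict S (H \<alpha>) = B \<alpha>" by blast
    have SB: "S x = B \<alpha> x" if "x \<in> H \<alpha>" for x \<alpha>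
      using fun_cong[OF S(2), of \<alpha> x] that by simp
    have m: "S x \<in> H \<alpha>" if "x \<in> H \<alpha>" for x \<alpha> by (rule local_algebra_maps[OF S(1) that])
    have "compose D (\<lambda>x\<in>D. l *\<^sub>C x - T x) S = (\<lambda>x\<in>D. x)"
      "compose D S (\<lambda>x\<in>D. l *\<^sub>C x - T x) = (\<lambda>x\<in>D. x)"
      unfolding compose_def
    proof (rule_tac [!] restrict_ext)
      fix x assume x: "x \<in> D"
      then obtain \<alpha> where a: "x \<in> H \<alpha>" by (metis domain_obtain2)
      show "(\<lambda>x\<in>D. l *\<^sub>C x - T x) (S x) = x"
        using H_domain[OF m[OF a]] B(3)[OF a] by (simp add: SB[OF a])
      show "S ((\<lambda>x\<in>D. l *\<^sub>C x - T x) x) = x"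
        using x a B(2)[OF a] SB[of "l *\<^sub>C x - T x" \<alpha>] by simp
    qed
    then have "l \<notin> local_spectrum H T"
      using S(1) resolvent_local by (auto simp: local_spectrum_def spectrum_in_def invertible_in_def)
    with l show False by blast
  qed
qed

section \<open>The functional calculus across the levels of a normal element\<close>

context
  assumes normal_T: "local_normal H T"
begin

lemma calc_orth_proj:
  assumes le: "\<alpha> \<le> \<beta>" and F: "calc (H \<beta>) (T\<^sub>r \<beta>) f F" and x: "x \<in> H \<beta>"
  shows "orth_proj (H \<alpha>) (F x) = F (orth_proj (H \<alpha>) x)"
proof -
  interpret normal_operator "H \<beta>" "T\<^sub>r \<beta>" by (rule normal_operator_restrict[OF normal_T])
  let ?P = "\<lambda>x\<in>H \<beta>. orth_proj (H \<alpha>) x"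
  have m: "orth_proj (H \<alpha>) y \<in> H \<beta>" for y using H_mono[OF le] by simp
  have "?P (F x) = F (?P x)"
  proof (rule calc_commute[OF F _ _ _ x])
    show "?P \<in> bounded_ops (H \<beta>)"
      by (rule sub.orth_proj_op[OF closed_csubspace_H increasing_H[OF le]])
  qed (simp_all add: T_orth_proj adjoint_orth_proj[OF le] m)
  then show ?thesis using x calc_op[OF F] by simp
qed

text \<open>All rules are compatible with restriction to a reducing subspace. In the limit rule the
  error on the larger spectrum controls that on the smaller one by \<open>op_spectrum_mono\<close>;
  for products, the inner factor must map \<open>H \<alpha>\<close> into itself, which comes from
  commuting with the projection.\<close>

lemma calc_restrict:
  assumes le: "\<alpha> \<le> \<beta>" and "calc (H \<beta>) (T\<^sub>r \<beta>) f F"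
  shows "calc (H \<alpha>) (T\<^sub>r \<alpha>) f (restrict F (H \<alpha>))"
proof -
  have maps: "F x \<in> H \<alpha>" if "calc (H \<beta>) (T\<^sub>r \<beta>) f F" "x \<in> H \<alpha>" for f F x
    using calc_orth_proj[OF le that(1) H_mono[OF le that(2)]] sub.orth_proj_mem sub.orth_proj_self[OF that(2)]
    by metis
  note sub_le = H_mono[OF le]
  from assms(2) show ?thesis
  proof (induction rule: calc.induct)
    case (const c)
    have "restrict (\<lambda>x\<in>H \<beta>. c *\<^sub>C x) (H \<alpha>) = (\<lambda>x\<in>H \<alpha>. c *\<^sub>C x)"
      by (rule restrict_ext) (simp add: sub_le)
    then show ?case using calc.const by metis
  next
    case ident
    have "restrict (T\<^sub>r \<beta>) (H \<alpha>) = T\<^sub>r \<alpha>" by (rule restrict_ext) (simp add: sub_le)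
    then show ?case using calc.ident by metis
  next
    case conj
    have "restrict (op_adjoint (H \<beta>) (T\<^sub>r \<beta>)) (H \<alpha>) = restrict (op_adjoint (H \<alpha>) (T\<^sub>r \<alpha>)) (H \<alpha>)"
      by (rule restrict_ext) (rule adjoint_restrict[OF le])
    then show ?case using calc.conj by (metis sub.restrict_op sub.op_adjoint_op T_op)
  next
    case (add f F g G)
    have eq: "restrict (\<lambda>x\<in>H \<beta>. F x + G x) (H \<alpha>) = (\<lambda>x\<in>H \<alpha>. restrict F (H \<alpha>) x + restrict G (H \<alpha>) x)"
      by (rule restrict_ext) (simp add: sub_le)
    show ?case unfolding eq by (rule calc.add[OF add.IH])
  next
    case (mult f F g G)
    have eq: "restrict (compose (H \<beta>) F G) (H \<alpha>) = compose (H \<alpha>) (restrict F (H \<alpha>)) (restrict G (H \<alpha>))"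
      unfolding compose_def by (rule restrict_ext) (simp add: sub_le maps[OF mult.hyps(2)])
    show ?case unfolding eq by (rule calc.mult[OF mult.IH])
  next
    case (limit F f)
    have F: "calc (H \<beta>) (T\<^sub>r \<beta>) f F"
      using limit.hyps limit.IH by (intro calc.limit) blast+
    show ?case
    proof (rule calc.limit)
      show "restrict F (H \<alpha>) \<in> bounded_ops (H \<alpha>)"
        using sub.op_restrict_subspace[OF limit.hyps closed_csubspace_H increasing_H[OF le]] maps[OF F] by blast
      fix e :: real assume "e > 0"
      then obtain g G where g: "calc (H \<alpha>) (T\<^sub>r \<alpha>) g (restrict G (H \<alpha>))"
          "\<forall>z\<in>op_spectrum (H \<beta>) (T\<^sub>r \<beta>). cmod (f z - g z) \<le> e"
          "\<forall>x\<in>H \<beta>. norm (F x - G x) \<le> e * norm x"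
        using limit.IH by blast
      show "\<exists>g G. calc (H \<alpha>) (T\<^sub>r \<alpha>) g G \<and> (\<forall>z\<in>op_spectrum (H \<alpha>) (T\<^sub>r \<alpha>). cmod (f z - g z) \<le> e) \<and>
          (\<forall>x\<in>H \<alpha>. norm (restrict F (H \<alpha>) x - G x) \<le> e * norm x)"
        using g op_spectrum_mono[OF le] sub_le
        by (intro exI[of _ g] exI[of _ "restrict G (H \<alpha>)"]) auto
    qed
  qed
qed

context
  fixes f :: "complex \<Rightarrow> complex"
  assumes f: "continuous_map (local_spectrum_topology H T) euclidean f"
begin

text \<open>Open sets of the inductive limit topology meet each level spectrum in a relatively open
  set, so continuity there gives ordinary continuity on every level.\<close>

lemma continuous_on_op_spectrum: "continuous_on (op_spectrum (H \<alpha>) (T\<^sub>r \<alpha>)) f"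
proof -
  have top: "topspace (local_spectrum_topology H T) = local_spectrum H T"
    by (rule topspace_local_spectrum_topology) (auto simp: local_spectrum_eq)
  show ?thesis
    unfolding continuous_openin_preimage_eq
  proof (intro allI impI)
    fix U :: "complex set" assume "open U"
    then have "openin (local_spectrum_topology H T) {z \<in> local_spectrum H T. f z \<in> U}"
      using openin_continuous_map_preimage[OF f, of U] by (simp add: top)
    moreover have "{z \<in> local_spectrum H T. f z \<in> U} \<inter> op_spectrum (H \<alpha>) (T\<^sub>r \<alpha>) =
        op_spectrum (H \<alpha>) (T\<^sub>r \<alpha>) \<inter> f -` U"
      by (auto simp: local_spectrum_eq)
    ultimately show "openin (top_of_set (op_spectrum (H \<alpha>) (T\<^sub>r \<alpha>))) (op_spectrum (H \<alpha>) (T\<^sub>r \<alpha>) \<inter> f -` U)"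
      unfolding openin_local_spectrum_topology by metis
  qed
qed

lemma apply_fun_calc: "calc (H \<alpha>) (T\<^sub>r \<alpha>) f (apply_fun (H \<alpha>) f (T\<^sub>r \<alpha>))"
  by (rule normal_operator.calc_apply_fun[OF normal_operator_restrict[OF normal_T] continuous_on_op_spectrum])

text \<open>Gluing again: coherence holds because \<open>calc_restrict\<close> and
  \<open>apply_fun\<close> give two values of the calculus on \<open>H \<alpha>\<close> at the same
  f, equal by \<open>calc_unique\<close>.\<close>

lemma local_apply_fun_restrict:
  "local_apply_fun H f T \<in> local_algebra H \<and>
    (\<forall>\<alpha>. restrict (local_apply_fun H f T) (H \<alpha>) = apply_fun (H \<alpha>) f (T\<^sub>r \<alpha>))"
proof -
  have "\<exists>!S. S \<in> local_algebra H \<and> (\<forall>\<alpha>. restrict S (H \<alpha>) = apply_fun (H \<alpha>) f (T\<^sub>r \<alpha>))"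
  proof (rule local_algebra_glue)
    fix \<alpha>
    show "apply_fun (H \<alpha>) f (T\<^sub>r \<alpha>) \<in> bounded_ops (H \<alpha>)"
      by (rule normal_operator.calc_op[OF normal_operator_restrict[OF normal_T] apply_fun_calc])
  next
    fix \<alpha> \<beta> x assume le: "\<alpha> \<le> \<beta>" and x: "x \<in> H \<alpha>"
    have "restrict (apply_fun (H \<beta>) f (T\<^sub>r \<beta>)) (H \<alpha>) = apply_fun (H \<alpha>) f (T\<^sub>r \<alpha>)"
      by (rule normal_operator.calc_unique[OF normal_operator_restrict[OF normal_T]
          calc_restrict[OF le apply_fun_calc] apply_fun_calc])
    from fun_cong[OF this, of x] show "apply_fun (H \<beta>) f (T\<^sub>r \<beta>) x = apply_fun (H \<alpha>) f (T\<^sub>r \<alpha>) x"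
      using x by simp
  qed (rule calc_orth_proj[OF _ apply_fun_calc])
  from theI'[OF this] show ?thesis unfolding local_apply_fun_def .
qed

end

end

end

text \<open>Both local spectra are unions over the same indices, and taking images commutes with
  unions. \<open>local_spectrum_eq\<close> applies to f(T) simply as an element of the local
  algebra.\<close>

lemma local_spectral_mapping:
  assumes T: "T \<in> local_algebra H" and n: "local_normal H T"
    and f: "continuous_map (local_spectrum_topology H T) euclidean f"
  shows "local_spectrum H (local_apply_fun H f T) = f ` local_spectrum H T"
proof -
  let ?S = "local_apply_fun H f T"
  have S: "?S \<in> local_algebra H"
    "\<And>\<alpha>. restrict ?S (H \<alpha>) = apply_fun (H \<alpha>) f (restrict T (H \<alpha>))"
    using local_apply_fun_restrict[OF T n f] by blast+
  have "op_spectrum (H \<alpha>) (restrict ?S (H \<alpha>)) = f ` op_spectrum (H \<alpha>) (restrict T (H \<alpha>))" for \<alpha>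
    unfolding S(2)
    by (rule normal_operator.calc_spectrum[OF normal_operator_restrict[OF T n] apply_fun_calc[OF T n f]])
  then show ?thesis
    by (simp only: local_spectrum_eq[OF S(1)] local_spectrum_eq[OF T] image_UN)
qed

end

theorem theorem3p16:
  fixes H :: "'i::order \<Rightarrow> 'a::complex_hilbert set"
    and T :: "'a \<Rightarrow> 'a"
    and f :: "complex \<Rightarrow> complex"
  assumes "subspace_family H"
    and "T \<in> local_algebra H"
    and "local_normal H T"
    and "continuous_map (local_spectrum_topology H T) euclidean f"
  shows "local_spectrum H (local_apply_fun H f T) = f ` local_spectrum H T"
  using assms by (rule subspace_family.local_spectral_mapping)

end
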